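(* Let $d\ge 1$ and $\sigma>0$ satisfy $1<\sigma d<2$, let $p^*:=\frac{\sigma d}{\sigma d-1}$, and let $p^*<p\le\infty$. Then the nonlinear Schr\"odinger equation $$ i\psi_t(t,\mathbf{x})+\Delta\psi+|\psi|^{2\sigma}\psi=0,\qquad \mathbf{x}\in\mathbb{R}^d,$$ admits classical (smooth) solutions $\psi$ that become singular at a finite time $T_c$ in $L^p$, i.e., $\|\psi(t)\|_p<\infty$ for $0\le t<T_c$ and $\lim_{t\to T_c}\|\psi(t)\|_p=\infty$.
   Context: $\Delta=\sum_{j=1}^d\partial_{x_jx_j}$ is the Laplacian on $\mathbb{R}^d$, and $\|\cdot\|_p$ denotes the $L^p(\mathbb{R}^d)$ norm in the spatial variable $\mathbf{x}$. *)

theory Defs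
  imports "HOL-Analysis.Analysis" "HOL-Probability.Essential_Supremum"
begin

text \<open>C^k on an open set S: k times (Frechet) differentiable with continuous
  k-th derivatives (expressed via all directional derivatives).\<close>
fun Ck_on :: "nat \<Rightarrow> 'a::euclidean_space set \<Rightarrow> ('a \<Rightarrow> 'b::real_normed_vector) \<Rightarrow> bool" where
  "Ck_on 0 S f = continuous_on S f"
| "Ck_on (Suc k) S f =
     (\<exists>Df. (\<forall>x\<in>S. (f has_derivative Df x) (at x)) \<and> (\<forall>v. Ck_on k S (\<lambda>x. Df x v)))"

definition smooth_on :: "'a::euclidean_space set \<Rightarrow> ('a \<Rightarrow> 'b::real_normed_vector) \<Rightarrow> bool" where
  "smooth_on S f \<longleftrightarrow> (\<forall>k. Ck_on k S f)"

definition partial_x :: "'n::finite \<Rightarrow> (real^'n \<Rightarrow> complex) \<Rightarrow> real^'n \<Rightarrow> complex" where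
  "partial_x j f x = vector_derivative (\<lambda>h. f (x + h *\<^sub>R axis j 1)) (at 0)"

definition laplacian :: "(real^'n::finite \<Rightarrow> complex) \<Rightarrow> real^'n \<Rightarrow> complex" where
  "laplacian f x = (\<Sum>j\<in>UNIV. partial_x j (partial_x j f) x)"

definition partial_t :: "(real \<Rightarrow> real^'n::finite \<Rightarrow> complex) \<Rightarrow> real \<Rightarrow> real^'n \<Rightarrow> complex" where
  "partial_t \<psi> t x = vector_derivative (\<lambda>s. \<psi> s x) (at t)"

definition lp_norm :: "ereal \<Rightarrow> (real^'n::finite \<Rightarrow> complex) \<Rightarrow> ereal" where
  "lp_norm p f =
    (if p = \<infinity> then esssup lborel (\<lambda>x. ereal (cmod (f x)))
     else (let I = (\<integral>\<^sup>+ x. ennreal (cmod (f x) powr real_of_ereal p) \<partial>lborel)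
           in if I = \<infinity> then \<infinity> else ereal (enn2real I powr (1 / real_of_ereal p))))"

end

theory Submission
  imports Defs
begin

text \<open>
  The solutions are self-similar: \<open>\<psi>(t, x) = (1 - t)\<^bsup>-1/(2\<sigma>)\<^esup> q(|x|\<^sup>2 / (1 - t))\<close>, where \<open>q\<close> solves
  \<open>4 s q'' + 2 d q' + \<i> s q' + \<i>/(2\<sigma>) q + |q|\<^bsup>2\<sigma>\<^esup> q = 0\<close> on the half line. In the radial variable \<open>r\<close> the modes at infinity
  decay like \<open>r\<^bsup>-1/\<sigma>\<^esup>\<close> and \<open>r\<^bsup>-(d - 1/\<sigma>)\<^esup>\<close>, the second being the slower one, and it lies in \<open>L\<^sup>p\<close> exactly for \<open>p > p\<^sup>*\<close>.
  The solution regular at the origin is obtained from a fixed point argument for an equation with truncated nonlinearity;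
  for small data an energy estimate gives decay at any rate below \<open>d - 1/\<sigma>\<close> and shows that the truncation is inactive.
  An angular momentum identity shows that \<open>q\<close> has no zeros, whence \<open>|q|\<^bsup>2\<sigma>\<^esup> q\<close> is smooth although \<open>\<sigma>\<close> need
  not be an integer. Finally \<open>\<parallel>\<psi>(t)\<parallel>\<^sub>p\<close> is a constant times \<open>(1 - t)\<^bsup>d/(2p) - 1/(2\<sigma>)\<^esup>\<close>, with a negative exponent because \<open>p > \<sigma> d\<close>.
\<close>

section \<open>Smoothness within a set\<close>

text \<open>Derivatives are taken within \<open>S\<close>, so that a profile on the closed half line \<open>{0..}\<close> may be
  composed with the nonnegative function \<open>|x|\<^sup>2 / (1 - t)\<close>, also at \<open>x = 0\<close>.\<close>

fun Ck_within :: "nat \<Rightarrow> 'a::euclidean_space set \<Rightarrow> ('a \<Rightarrow> 'b::real_normed_vector) \<Rightarrow> bool" where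
  "Ck_within 0 S f = continuous_on S f"
| "Ck_within (Suc k) S f =
     (\<exists>Df. (\<forall>x\<in>S. (f has_derivative Df x) (at x within S)) \<and> (\<forall>v. Ck_within k S (\<lambda>x. Df x v)))"

text \<open>The bridge back to \<open>Ck_on\<close>: at a point of an open set the derivative within
  the set is the full derivative.\<close>

lemma Ck_within_open:
  assumes "open S"
  shows "Ck_within k S f \<longleftrightarrow> Ck_on k S f"
proof (induction k arbitrary: f)
  case (Suc k)
  have "(f has_derivative D) (at x within S) \<longleftrightarrow> (f has_derivative D) (at x)" if "x \<in> S" for x D
    by (simp only: at_within_open[OF that assms])
  then show ?case using Suc by simp
qed simp

lemma Ck_within_cong:
  assumes "Ck_within k S f" "\<And>x. x \<in> S \<Longrightarrow> f x = g x"
  shows "Ck_within k S g"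
proof (cases k)
  case 0
  then show ?thesis using assms continuous_on_cong[of S S f g] by simp
next
  case (Suc m)
  with assms(1) obtain Df where D: "\<forall>x\<in>S. (f has_derivative Df x) (at x within S)"
    "\<forall>v. Ck_within m S (\<lambda>x. Df x v)" by auto
  have "(g has_derivative Df x) (at x within S)" if "x \<in> S" for x
    using D(1) that assms(2) has_derivative_transform[of x S g f "Df x"] by simp
  with D(2) Suc show ?thesis by auto
qed

lemma Ck_within_Suc_D: "Ck_within (Suc k) S f \<Longrightarrow> Ck_within k S f"
proof (induction k arbitrary: f)
  case 0
  then show ?case
    by (auto simp: continuous_on_eq_continuous_within intro: has_derivative_continuous)
next
  case (Suc k)
  from Suc.prems obtain Df where "\<forall>x\<in>S. (f has_derivative Df x) (at x within S)"
    and "\<forall>v. Ck_within (Suc k) S (\<lambda>x. Df x v)" unfolding Ck_within.simps(2)[of "Suc k"] by blast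
  with Suc.IH show ?case unfolding Ck_within.simps(2)[of k] by blast
qed

lemma Ck_within_continuous: "Ck_within k S f \<Longrightarrow> continuous_on S f"
proof (induction k)
  case (Suc k)
  from Suc.IH[OF Ck_within_Suc_D[OF Suc.prems]] show ?case .
qed simp

lemma Ck_within_const: "Ck_within k S (\<lambda>x. c)"
proof (induction k arbitrary: c)
  case (Suc k)
  then show ?case by (auto intro!: exI[of _ "\<lambda>x v. 0"])
qed simp

lemma Ck_within_linear:
  assumes "bounded_linear L" "Ck_within k S f"
  shows "Ck_within k S (\<lambda>x. L (f x))"
  using assms(2)
proof (induction k arbitrary: f)
  case 0
  then show ?case using assms(1) by (simp add: linear_continuous_on_compose linear_linear bounded_linear.continuous_on)
next
  case (Suc k)
  then obtain Df where D: "\<forall>x\<in>S. (f has_derivative Df x) (at x within S)"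
    "\<forall>v. Ck_within k S (\<lambda>x. Df x v)" by auto
  show ?case
    using D Suc.IH by (auto intro!: exI[of _ "\<lambda>x v. L (Df x v)"] bounded_linear.has_derivative[OF assms(1)])
qed

lemma Ck_within_id: "Ck_within k S (\<lambda>x. x)"
proof (cases k)
  case (Suc m)
  then show ?thesis by (auto intro!: exI[of _ "\<lambda>x v. v"] Ck_within_const)
qed simp

lemma Ck_within_add:
  assumes "Ck_within k S f" "Ck_within k S g"
  shows "Ck_within k S (\<lambda>x. f x + g x)"
  using assms
proof (induction k arbitrary: f g)
  case 0
  then show ?case by (simp add: continuous_on_add)
next
  case (Suc k)
  then obtain Df Dg where "\<forall>x\<in>S. (f has_derivative Df x) (at x within S)"
    "\<forall>v. Ck_within k S (\<lambda>x. Df x v)"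
    "\<forall>x\<in>S. (g has_derivative Dg x) (at x within S)"
    "\<forall>v. Ck_within k S (\<lambda>x. Dg x v)" by auto
  then show ?case
    using Suc.IH by (auto intro!: exI[of _ "\<lambda>x v. Df x v + Dg x v"] has_derivative_add)
qed

lemma Ck_within_sum:
  assumes "\<And>i. i \<in> I \<Longrightarrow> Ck_within k S (f i)"
  shows "Ck_within k S (\<lambda>x. \<Sum>i\<in>I. f i x)"
  using assms by (induction I rule: infinite_finite_induct) (auto intro: Ck_within_add Ck_within_const)

lemma Ck_within_bilinear:
  assumes "bounded_bilinear B" "Ck_within k S f" "Ck_within k S g"
  shows "Ck_within k S (\<lambda>x. B (f x) (g x))"
  using assms(2,3)
proof (induction k arbitrary: f g)
  case 0
  then show ?case by (simp add: bounded_bilinear.continuous_on[OF assms(1)])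
next
  case (Suc k)
  then obtain Df Dg where D: "\<forall>x\<in>S. (f has_derivative Df x) (at x within S)"
    "\<forall>v. Ck_within k S (\<lambda>x. Df x v)"
    "\<forall>x\<in>S. (g has_derivative Dg x) (at x within S)"
    "\<forall>v. Ck_within k S (\<lambda>x. Dg x v)" by auto
  have "Ck_within k S f" "Ck_within k S g" using Suc.prems Ck_within_Suc_D by blast+
  then show ?case
    using D Suc.IH by (auto intro!: exI[of _ "\<lambda>x v. B (f x) (Dg x v) + B (Df x v) (g x)"]
       Ck_within_add bounded_bilinear.FDERIV[OF assms(1)])
qed

lemma Ck_within_compose:
  fixes g :: "'a::euclidean_space \<Rightarrow> 'b::euclidean_space" and f :: "'b \<Rightarrow> 'c::real_normed_vector"
  assumes "Ck_within k T f" "Ck_within k S g" "g ` S \<subseteq> T"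
  shows "Ck_within k S (\<lambda>x. f (g x))"
  using assms(1,2)
proof (induction k arbitrary: f)
  case 0
  then show ?case using assms(3) by (auto intro: continuous_on_compose2)
next
  case (Suc k)
  then obtain Df Dg where D: "\<forall>x\<in>T. (f has_derivative Df x) (at x within T)"
    "\<forall>v. Ck_within k T (\<lambda>x. Df x v)"
    "\<forall>x\<in>S. (g has_derivative Dg x) (at x within S)"
    "\<forall>v. Ck_within k S (\<lambda>x. Dg x v)" by auto
  have g: "Ck_within k S g" using Suc.prems Ck_within_Suc_D by blast
  \<comment> \<open>The direction \<open>Dg x v\<close> varies with \<open>x\<close>, while the
    induction hypothesis covers \<open>Df\<close> in fixed directions only. Expanding in the basis
    separates the two dependences.\<close>
  have "Ck_within k S (\<lambda>x. Df (g x) (Dg x v))" for v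
  proof (rule Ck_within_cong)
    show "Ck_within k S (\<lambda>x. \<Sum>b\<in>Basis. (Dg x v \<bullet> b) *\<^sub>R Df (g x) b)"
      using D(2,4) Suc.IH[of "\<lambda>y. Df y _"] g
      by (intro Ck_within_sum Ck_within_bilinear[OF bounded_bilinear_scaleR]
            Ck_within_linear[OF bounded_linear_inner_left]) blast+
  next
    fix x assume "x \<in> S"
    then have "linear (Df (g x))" using D assms(3) has_derivative_linear by blast
    then have "Df (g x) (\<Sum>b\<in>Basis. (Dg x v \<bullet> b) *\<^sub>R b) = (\<Sum>b\<in>Basis. (Dg x v \<bullet> b) *\<^sub>R Df (g x) b)"
      by (simp add: linear_sum linear_cmul)
    then show "(\<Sum>b\<in>Basis. (Dg x v \<bullet> b) *\<^sub>R Df (g x) b) = Df (g x) (Dg x v)"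
      by (simp add: euclidean_representation)
  qed
  moreover have "((\<lambda>x. f (g x)) has_derivative (\<lambda>v. Df (g x) (Dg x v))) (at x within S)" if "x \<in> S" for x
    using D assms(3) that by (intro has_derivative_in_compose2[of T f Df g S x "Dg x"]) auto
  ultimately show ?case
    unfolding Ck_within.simps(2) by (intro exI[of _ "\<lambda>x v. Df (g x) (Dg x v)"]) blast
qed

section \<open>Functions of one real variable: real powers and radial averages\<close>

lemma Ck_within_vector_derivative_I:
  fixes f :: "real \<Rightarrow> 'b::real_normed_vector"
  assumes "\<And>x. x \<in> S \<Longrightarrow> (f has_vector_derivative f' x) (at x within S)" "Ck_within k S f'"
  shows "Ck_within (Suc k) S f"
  using assms unfolding has_vector_derivative_def
  by (auto intro!: exI[of _ "\<lambda>x v. v *\<^sub>R f' x"] Ck_within_linear[OF bounded_linear_scaleR_right])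

lemma Ck_within_vector_derivative_E:
  fixes f :: "real \<Rightarrow> 'b::real_normed_vector"
  assumes "Ck_within (Suc k) S f"
  obtains f' where "\<And>x. x \<in> S \<Longrightarrow> (f has_vector_derivative f' x) (at x within S)" "Ck_within k S f'"
proof -
  from assms obtain Df where D: "\<forall>x\<in>S. (f has_derivative Df x) (at x within S)"
    "\<forall>v. Ck_within k S (\<lambda>x. Df x v)" by auto
  have "(f has_vector_derivative Df x 1) (at x within S)" if "x \<in> S" for x
  proof -
    have "linear (Df x)" using D that has_derivative_linear by blast
    then have "Df x = (\<lambda>v. v *\<^sub>R Df x 1)" by (auto simp: linear_cmul[symmetric])
    then show ?thesis using D that unfolding has_vector_derivative_def by metis
  qed
  then show thesis using D(2) by (intro that[of "\<lambda>x. Df x 1"]) auto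
qed

text \<open>The exponent is generalised because each derivative lowers it by one. The restriction to
  positive arguments is why the profile must be shown to have no zeros.\<close>

lemma Ck_within_powr: "Ck_within k {0<..} (\<lambda>x::real. x powr c)"
proof (induction k arbitrary: c)
  case 0
  then show ?case by (auto intro!: continuous_intros)
next
  case (Suc k)
  show ?case
  proof (rule Ck_within_vector_derivative_I)
    show "((\<lambda>x. x powr c) has_vector_derivative c *\<^sub>R x powr (c - 1)) (at x within {0<..})" if "x \<in> {0<..}" for x
      unfolding has_real_derivative_iff_has_vector_derivative[symmetric] using that
      by (auto intro!: derivative_eq_intros)
    show "Ck_within k {0<..} (\<lambda>x::real. c *\<^sub>R x powr (c - 1))"
      using Suc by (rule Ck_within_linear[OF bounded_linear_scaleR_right])
  qed
qed

text \<open>For \<open>m = d - 1\<close> this is the solution, regular at the origin, of \<open>s v' + (d/2) v = g\<close>, written after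
  the substitution \<open>u = s \<eta>\<^sup>2\<close> so that the smoothness of \<open>g\<close> at \<open>s = 0\<close> is inherited without a singular kernel.\<close>

definition radial_avg :: "nat \<Rightarrow> (real \<Rightarrow> complex) \<Rightarrow> real \<Rightarrow> complex" where
  "radial_avg m g s = integral {0..1} (\<lambda>\<eta>. (2 * \<eta> ^ m) *\<^sub>R g (s * \<eta>\<^sup>2))"

lemma continuous_on_radial_avg_integrand:
  fixes g :: "real \<Rightarrow> complex"
  assumes "continuous_on {0..} g"
  shows "continuous_on ({0..} \<times> {0..1}) (\<lambda>(s, \<eta>). (2 * \<eta> ^ m) *\<^sub>R g (s * \<eta>\<^sup>2))"
  unfolding case_prod_beta
  by (intro continuous_intros continuous_on_compose2[OF assms]) auto

lemma radial_avg_integrable: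
  fixes g :: "real \<Rightarrow> complex"
  assumes "continuous_on {0..} g" "s \<ge> 0"
  shows "(\<lambda>\<eta>. (2 * \<eta> ^ m) *\<^sub>R g (s * \<eta>\<^sup>2)) integrable_on {0..1}"
  by (intro integrable_continuous_real continuous_intros continuous_on_compose2[OF assms(1)])
     (use assms(2) in auto)

text \<open>Differentiation under the integral sign. The chain rule contributes
  \<open>\<eta>\<^sup>2\<close>, so \<open>m\<close> becomes \<open>m + 2\<close> and the induction
  has to run over all \<open>m\<close>.\<close>

lemma Ck_within_radial_avg:
  "Ck_within k {0..} g \<Longrightarrow> Ck_within k {0..} (radial_avg m g)"
proof (induction k arbitrary: g m)
  case 0
  then show ?case
    using integral_continuous_on_param[of "{0..}" 0 1 "\<lambda>s \<eta>. (2 * \<eta> ^ m) *\<^sub>R g (s * \<eta>\<^sup>2)"]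
      continuous_on_radial_avg_integrand[of g m]
    by (simp add: radial_avg_def[abs_def])
next
  case (Suc k)
  then obtain g' where g': "\<And>x. x \<in> {0..} \<Longrightarrow> (g has_vector_derivative g' x) (at x within {0..})"
    "Ck_within k {0..} g'" using Ck_within_vector_derivative_E by blast
  have gc: "continuous_on {0..} g" using Suc.prems Ck_within_continuous by blast
  have g'c: "continuous_on {0..} g'" using g' Ck_within_continuous by blast
  show ?case
  proof (rule Ck_within_vector_derivative_I[where f'="radial_avg (m+2) g'"])
    fix s :: real assume s: "s \<in> {0..}"
    have *: "((\<lambda>s. (2 * \<eta> ^ m) *\<^sub>R g (s * \<eta>\<^sup>2)) has_vector_derivative (2 * \<eta> ^ (m+2)) *\<^sub>R g' (u * \<eta>\<^sup>2)) (at u within {0..})"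
      if "u \<in> {0..}" for u \<eta> :: real
    proof -
      have "((g \<circ> (\<lambda>s. s * \<eta>\<^sup>2)) has_vector_derivative \<eta>\<^sup>2 *\<^sub>R g' (u * \<eta>\<^sup>2)) (at u within {0..})"
      proof (rule vector_diff_chain_within)
        show "((\<lambda>s. s * \<eta>\<^sup>2) has_vector_derivative \<eta>\<^sup>2) (at u within {0..})"
          by (auto intro!: derivative_eq_intros simp: has_real_derivative_iff_has_vector_derivative[symmetric])
        show "(g has_vector_derivative g' (u * \<eta>\<^sup>2)) (at (u * \<eta>\<^sup>2) within (\<lambda>s. s * \<eta>\<^sup>2) ` {0..})"
          using that by (intro has_vector_derivative_within_subset[OF g'(1)]) auto
      qed
      from bounded_linear.has_vector_derivative[OF bounded_linear_scaleR_right this, of "2 * \<eta> ^ m"]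
      show ?thesis by (simp add: o_def power_add mult_ac power2_eq_square)
    qed
    have "((\<lambda>s. integral (cbox 0 1) (\<lambda>\<eta>. (2 * \<eta> ^ m) *\<^sub>R g (s * \<eta>\<^sup>2))) has_vector_derivative
        integral (cbox 0 1) (\<lambda>\<eta>. (2 * \<eta> ^ (m+2)) *\<^sub>R g' (s * \<eta>\<^sup>2))) (at s within {0..})"
      using continuous_on_radial_avg_integrand[OF g'c, of "m+2"] radial_avg_integrable[OF gc] s
      by (intro leibniz_rule_vector_derivative[where f="\<lambda>s \<eta>. (2 * \<eta> ^ m) *\<^sub>R g (s * \<eta>\<^sup>2)"
            and fx="\<lambda>s \<eta>. (2 * \<eta> ^ (m+2)) *\<^sub>R g' (s * \<eta>\<^sup>2)"])
         (simp_all only: * cbox_interval atLeast_iff convex_real_interval)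
    then show "(radial_avg m g has_vector_derivative radial_avg (m+2) g' s) (at s within {0..})"
      unfolding radial_avg_def[abs_def] cbox_interval .
  next
    show "Ck_within k {0..} (radial_avg (m + 2) g')" using Suc.IH g' by blast
  qed
qed

section \<open>A Volterra equation on the half line\<close>

text \<open>Picard iteration on the whole half line at once, for an \<open>F\<close> that may be
  nonlocal. In the norm weighted by \<open>exp (- 2 * L * s)\<close>, integrating the Lipschitz
  bound gains a factor \<open>1 / (2 * L)\<close>, so the integral operator contracts by
  1/2.\<close>

lemma volterra_exists:
  fixes F :: "(real \<Rightarrow> complex) \<Rightarrow> real \<Rightarrow> complex" and q0 :: complex
  assumes L: "L > 0"
    and cont: "\<And>a. continuous_on {0..} a \<Longrightarrow> continuous_on {0..} (F a)"
    and lip: "\<And>a b M s. \<lbrakk>continuous_on {0..} a; continuous_on {0..} b;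
       \<And>u. u \<ge> 0 \<Longrightarrow> cmod (a u - b u) \<le> M * exp (2 * L * u); s \<ge> 0\<rbrakk>
       \<Longrightarrow> cmod (F a s - F b s) \<le> L * M * exp (2 * L * s)"
    and zero: "\<And>s. F (\<lambda>_. 0) s = 0"
  obtains q where "continuous_on {0..} q" "q 0 = q0"
    "\<And>s. s \<ge> 0 \<Longrightarrow> (q has_vector_derivative F q s) (at s within {0..})"
    "\<And>s. s \<ge> 0 \<Longrightarrow> cmod (q s) \<le> 2 * cmod q0 * exp (2 * L * s)"
proof -
  \<comment> \<open>\<open>max 0 s\<close> extends the integral by 0 to negative \<open>s\<close>,
    because the fixed point is sought among bounded continuous functions on the whole line.\<close>
  define W where "W a s = integral {0..max 0 s} (F a)" for a s
  have integrable: "F a integrable_on {0..s}" if "continuous_on {0..} a" for a s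
    using cont[OF that] by (intro integrable_continuous_real) (auto elim: continuous_on_subset)
  have deriv: "(W a has_vector_derivative F a s) (at s within {0..})"
    if "continuous_on {0..} a" "s \<ge> 0" for a s
  proof -
    have "((\<lambda>u. integral {0..u} (F a)) has_vector_derivative F a s) (at s within {0..s+1})"
      using that by (intro integral_has_vector_derivative continuous_on_subset[OF cont]) auto
    then have "((\<lambda>u. integral {0..u} (F a)) has_vector_derivative F a s) (at s within {0..})"
      using that by (subst (asm) at_within_nhd[of s "{s-1<..<s+1}" "{0..s+1}" "{0..}"]) auto
    then show ?thesis
      by (rule has_vector_derivative_transform[rotated 2]) (use that in \<open>auto simp: W_def max_def\<close>)
  qed
  have Wcont: "continuous_on UNIV (W a)" if "continuous_on {0..} a" for a
  proof -
    have "continuous_on {0..} (W a)"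
      using deriv[OF that] by (auto simp: continuous_on_eq_continuous_within intro: has_vector_derivative_continuous)
    then have "continuous_on UNIV (\<lambda>s. W a (max 0 s))"
      by (rule continuous_on_compose2) (auto intro!: continuous_intros)
    then show ?thesis by (simp add: W_def)
  qed
  have Wlip: "cmod (W a s - W b s) \<le> M / 2 * exp (2 * L * max 0 s)"
    if c: "continuous_on {0..} a" "continuous_on {0..} b"
      and M: "\<And>u. u \<ge> 0 \<Longrightarrow> cmod (a u - b u) \<le> M * exp (2 * L * u)" for a b M s
  proof -
    define r where "r = max 0 s"
    have r: "r \<ge> 0" by (simp add: r_def)
    have M0: "M \<ge> 0" using M[of 0] order_trans[OF norm_ge_zero] by fastforce
    have "((\<lambda>u. L * M * exp (2 * L * u)) has_integral M / 2 * exp (2 * L * r) - M / 2 * exp (2 * L * 0)) {0..r}"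
      using r L by (intro fundamental_theorem_of_calculus)
        (auto intro!: derivative_eq_intros simp: has_real_derivative_iff_has_vector_derivative[symmetric])
    note I = this[THEN integral_unique] this[THEN has_integral_integrable]
    have "W a s - W b s = integral {0..r} (\<lambda>u. F a u - F b u)"
      unfolding W_def r_def by (rule integral_diff[symmetric]) (auto intro: integrable c)
    also have "cmod \<dots> \<le> integral {0..r} (\<lambda>u. L * M * exp (2 * L * u))"
      by (intro integral_norm_bound_integral integrable_diff integrable c I(2) lip M) auto
    also have "\<dots> \<le> M / 2 * exp (2 * L * r)" using I(1) M0 by simp
    finally show ?thesis by (simp add: r_def)
  qed
  define E where "E u s = exp (2 * L * s) *\<^sub>R apply_bcontfun u s" for u :: "real \<Rightarrow>\<^sub>C complex" and s
  have Ec: "continuous_on S (E u)" for u S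
    unfolding E_def[abs_def] by (intro continuous_intros continuous_on_apply_bcontfun)
  have Ed: "cmod (E u s - E w s) \<le> dist u w * exp (2 * L * s)" for u w s
  proof -
    have "cmod (E u s - E w s) = exp (2 * L * s) * dist (apply_bcontfun u s) (apply_bcontfun w s)"
      by (simp add: E_def scaleR_diff_right[symmetric] dist_norm)
    then show ?thesis using dist_bounded[of u s w] by (simp add: mult.commute)
  qed
  \<comment> \<open>The Picard map for the rescaled unknown; on the half line \<open>E\<close>
    removes the weight that \<open>P\<close> puts back.\<close>
  define P where "P u s = exp (- 2 * L * max 0 s) *\<^sub>R (q0 + W (E u) s)" for u s
  have Pd: "cmod (P u s - P w s) \<le> (1/2) * dist u w" for u w s
  proof -
    have "P u s - P w s = exp (- 2 * L * max 0 s) *\<^sub>R (W (E u) s - W (E w) s)"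
      by (simp add: P_def algebra_simps)
    then have "cmod (P u s - P w s) = exp (- 2 * L * max 0 s) * cmod (W (E u) s - W (E w) s)"
      by simp
    also have "\<dots> \<le> exp (- 2 * L * max 0 s) * (dist u w / 2 * exp (2 * L * max 0 s))"
      by (intro mult_left_mono Wlip Ec Ed) auto
    also have "\<dots> = (1/2) * dist u w" by (simp add: exp_minus)
    finally show ?thesis .
  qed
  have E0: "E 0 = (\<lambda>_. 0)" by (auto simp: E_def)
  have W0: "W (\<lambda>_. 0) s = 0" for s 
    unfolding W_def by (subst integral_cong[where g="\<lambda>_. 0"]) (auto simp: zero)
  have P0: "cmod (P 0 s) \<le> cmod q0" for s
  proof -
    have "exp (- 2 * L * max 0 s) \<le> 1" using L by (simp add: mult_nonneg_nonneg)
    from mult_right_mono[OF this norm_ge_zero[of q0]] show ?thesis by (simp add: P_def E0 W0)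
  qed
  have Pb: "cmod (P u s) \<le> cmod q0 + (1/2) * norm u" for u s
    using norm_triangle_ineq[of "P 0 s" "P u s - P 0 s"] P0[of s] Pd[of u s 0] by simp
  have Pin: "P u \<in> bcontfun" for u
  proof (rule bcontfun_normI)
    show "continuous_on UNIV (P u)"
      unfolding P_def[abs_def] by (intro continuous_intros Wcont Ec)
  qed (rule Pb)
  define T where "T u = Bcontfun (P u)" for u
  have T: "apply_bcontfun (T u) = P u" for u
    unfolding T_def using Pin by (simp add: Bcontfun_inverse)
  have "dist (T u) (T w) \<le> (1/2) * dist u w" for u w
    by (rule dist_bound) (simp only: T dist_complex_def Pd)
  then have "\<exists>!u. T u = u"
    by (intro banach_fix_type[of "1/2"]) auto
  then obtain u where u: "T u = u" by blast
  define q where "q = E u"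
  \<comment> \<open>Solving this inequality for \<open>norm u\<close> gives the factor 2 in the
    exponential bound.\<close>
  have "norm u \<le> cmod q0 + (1/2) * norm u"
    by (rule norm_bound) (metis Pb T u)
  then have nu: "norm u \<le> 2 * cmod q0" by simp
  have qeq: "q s = q0 + W q s" if "s \<ge> 0" for s
  proof -
    have "apply_bcontfun u s = P u s" using T u by metis
    then show ?thesis using that by (simp add: q_def E_def[of u s] P_def exp_minus)
  qed
  show thesis
  proof
    show qc: "continuous_on {0..} q" unfolding q_def by (rule Ec)
    show "q 0 = q0" using qeq[of 0] by (simp add: W_def)
    fix s :: real assume s: "s \<ge> 0"
    have "((\<lambda>s. q0 + W q s) has_vector_derivative F q s) (at s within {0..})"
      using deriv[OF qc s] by (auto intro!: derivative_eq_intros)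
    then show "(q has_vector_derivative F q s) (at s within {0..})"
      by (rule has_vector_derivative_transform[rotated 2]) (use s qeq in auto)
    have "cmod (q s) = exp (2 * L * s) * cmod (apply_bcontfun u s)" by (simp add: q_def E_def)
    also have "\<dots> \<le> exp (2 * L * s) * (2 * cmod q0)"
      by (intro mult_left_mono) (use norm_bounded[of u s] nu in auto)
    finally show "cmod (q s) \<le> 2 * cmod q0 * exp (2 * L * s)" by (simp add: mult_ac)
  qed
qed

section \<open>The profile equation with a globally Lipschitz nonlinearity\<close>

lemma radial_avg_continuous: "continuous_on {0..} g \<Longrightarrow> continuous_on {0..} (radial_avg m g)"
  using Ck_within_radial_avg[of 0 g m] by simp

lemma radial_avg_diff:
  assumes "continuous_on {0..} g" "continuous_on {0..} h" "s \<ge> 0"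
  shows "radial_avg m (\<lambda>x. g x - h x) s = radial_avg m g s - radial_avg m h s"
  using integral_diff[OF radial_avg_integrable[OF assms(1,3)] radial_avg_integrable[OF assms(2,3)], of m m]
  by (simp add: radial_avg_def scaleR_diff_right)

text \<open>Since \<open>s * \<eta>\<^sup>2\<close> lies in [0, s], the average at \<open>s\<close>
  sees only values of \<open>g\<close> up to \<open>s\<close>; this gives the profile equation its
  Volterra structure.\<close>

lemma radial_avg_bound:
  assumes "continuous_on {0..} g" "s \<ge> 0" "\<And>u. 0 \<le> u \<Longrightarrow> u \<le> s \<Longrightarrow> cmod (g u) \<le> C"
  shows "cmod (radial_avg m g s) \<le> 2 * C"
proof -
  have C: "C \<ge> 0" using assms(3)[of 0] assms(2) order_trans[OF norm_ge_zero] by fastforce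
  have "cmod (radial_avg m g s) \<le> integral {0..1::real} (\<lambda>_. 2 * C)"
    unfolding radial_avg_def
  proof (rule integral_norm_bound_integral)
    show "(\<lambda>\<eta>. (2 * \<eta> ^ m) *\<^sub>R g (s * \<eta>\<^sup>2)) integrable_on {0..1}"
      by (rule radial_avg_integrable[OF assms(1,2)])
    fix \<eta> :: real assume \<eta>: "\<eta> \<in> {0..1}"
    then have "\<eta> ^ m \<le> 1" "0 \<le> \<eta> ^ m" "\<eta>\<^sup>2 \<le> 1" by (auto intro: power_le_one)
    moreover have "cmod (g (s * \<eta>\<^sup>2)) \<le> C"
      using \<open>\<eta>\<^sup>2 \<le> 1\<close> assms(2) by (intro assms(3)) (auto intro: mult_left_le)
    ultimately show "norm ((2 * \<eta> ^ m) *\<^sub>R g (s * \<eta>\<^sup>2)) \<le> 2 * C"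
      using mult_mono[of "\<eta> ^ m" 1 "cmod (g (s * \<eta>\<^sup>2))" C] C by simp
  qed auto
  then show ?thesis by simp
qed

text \<open>The second order equation becomes a first order one with a nonlocal term: the second
  unknown \<open>v\<close> is replaced by a radial average of \<open>N (q x)\<close>, which builds
  in regularity at the origin.\<close>

lemma radial_profile_exists:
  fixes N :: "complex \<Rightarrow> complex" and q0 :: complex
  assumes lip: "\<And>a b. cmod (N a - N b) \<le> K * cmod (a - b)" and N0: "N 0 = 0"
  obtains q where "continuous_on {0..} q" "q 0 = q0"
    "\<And>s. s \<ge> 0 \<Longrightarrow> (q has_vector_derivative (- \<i> * q s + radial_avg m (\<lambda>x. N (q x)) s) / 4) (at s within {0..})"
    "\<And>s. s \<ge> 0 \<Longrightarrow> cmod (q s) \<le> 2 * cmod q0 * exp ((1 + 2 * K) / 2 * s)"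
proof -
  have K: "K \<ge> 0" using lip[of 1 0] order_trans[OF norm_ge_zero] by fastforce
  \<comment> \<open>The term \<open>- \<i> * q s\<close> contributes 1 and the average
    \<open>2 * K\<close>, by \<open>radial_avg_bound\<close>; everything is divided by 4.\<close>
  define L where "L = (1 + 2 * K) / 4"
  define F where "F q s = (- \<i> * q s + radial_avg m (\<lambda>x. N (q x)) s) / 4" for q s
  have "K-lipschitz_on UNIV N" using lip K by (auto simp: lipschitz_on_def dist_norm)
  then have "continuous_on UNIV N" by (rule lipschitz_on_continuous_on)
  then have Nc: "continuous_on {0..} (\<lambda>x. N (a x))" if "continuous_on {0..} a" for a :: "real \<Rightarrow> complex"
    using that by (rule continuous_on_compose2) auto
  have "L > 0" using K by (simp add: L_def)
  then obtain q where "continuous_on {0..} q" "q 0 = q0"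
    "\<And>s. s \<ge> 0 \<Longrightarrow> (q has_vector_derivative F q s) (at s within {0..})"
    "\<And>s. s \<ge> 0 \<Longrightarrow> cmod (q s) \<le> 2 * cmod q0 * exp (2 * L * s)"
  proof (rule volterra_exists[of L F q0])
    show "continuous_on {0..} (F a)" if "continuous_on {0..} a" for a
      unfolding F_def[abs_def] by (intro continuous_intros radial_avg_continuous Nc that) auto
    show "F (\<lambda>_. 0) s = 0" for s by (simp add: F_def N0 radial_avg_def)
    fix a b :: "real \<Rightarrow> complex" and M s :: real
    assume c: "continuous_on {0..} a" "continuous_on {0..} b"
      and M: "\<And>u. u \<ge> 0 \<Longrightarrow> cmod (a u - b u) \<le> M * exp (2 * L * u)" and s: "s \<ge> 0"
    have M0: "M \<ge> 0" using M[of 0] order_trans[OF norm_ge_zero] by fastforce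
    have "cmod (radial_avg m (\<lambda>x. N (a x) - N (b x)) s) \<le> 2 * (K * (M * exp (2 * L * s)))"
    proof (rule radial_avg_bound)
      fix u assume u: "0 \<le> u" "u \<le> s"
      have "cmod (N (a u) - N (b u)) \<le> K * cmod (a u - b u)" by (rule lip)
      also have "\<dots> \<le> K * (M * exp (2 * L * u))" using M u K by (intro mult_left_mono) auto
      also have "\<dots> \<le> K * (M * exp (2 * L * s))"
        using u K M0 \<open>L > 0\<close> by (intro mult_left_mono) auto
      finally show "cmod (N (a u) - N (b u)) \<le> K * (M * exp (2 * L * s))" .
    qed (use Nc c s in \<open>auto intro!: continuous_intros\<close>)
    then have R: "cmod (radial_avg m (\<lambda>x. N (a x)) s - radial_avg m (\<lambda>x. N (b x)) s) \<le> 2 * (K * (M * exp (2 * L * s)))"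
      using radial_avg_diff[OF Nc[OF c(1)] Nc[OF c(2)] s] by simp
    have "F a s - F b s = (- \<i> * (a s - b s) + (radial_avg m (\<lambda>x. N (a x)) s - radial_avg m (\<lambda>x. N (b x)) s)) / 4"
      by (simp add: F_def algebra_simps diff_divide_distrib add_divide_distrib)
    also have "cmod \<dots> = cmod (- \<i> * (a s - b s) + (radial_avg m (\<lambda>x. N (a x)) s - radial_avg m (\<lambda>x. N (b x)) s)) / 4"
      by (simp add: norm_divide)
    also have "\<dots> \<le> (cmod (- \<i> * (a s - b s)) + cmod (radial_avg m (\<lambda>x. N (a x)) s - radial_avg m (\<lambda>x. N (b x)) s)) / 4"
      by (intro divide_right_mono norm_triangle_ineq) auto
    also have "\<dots> \<le> (M * exp (2 * L * s) + 2 * (K * (M * exp (2 * L * s)))) / 4"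
      using R M[OF s] by (intro divide_right_mono add_mono) (auto simp: norm_mult)
    also have "\<dots> = L * M * exp (2 * L * s)" by (simp add: L_def field_simps)
    finally show "cmod (F a s - F b s) \<le> L * M * exp (2 * L * s)" .
  qed blast
  then show thesis
  proof (intro that)
    have *: "2 * L = (1 + 2 * K) / 2" by (simp add: L_def)
    show "\<And>s. s \<ge> 0 \<Longrightarrow> cmod (q s) \<le> 2 * cmod q0 * exp ((1 + 2 * K) / 2 * s)"
      using \<open>\<And>s. s \<ge> 0 \<Longrightarrow> cmod (q s) \<le> 2 * cmod q0 * exp (2 * L * s)\<close> unfolding * .
  qed (auto simp: F_def)
qed

section \<open>The radial profile equation\<close>

text \<open>Substituting \<open>\<rho> = sqrt s * \<eta>\<close> turns the average into a power of
  \<open>sqrt s\<close> times an integral with variable upper end. The fundamental theorem of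
  calculus then applies to merely continuous \<open>g\<close>, before any smoothness of the profile
  is known.\<close>

lemma radial_avg_has_vector_derivative:
  assumes g: "continuous_on {0..} g" and s: "s > 0"
  shows "(radial_avg m g has_vector_derivative (g s - (real (Suc m) / 2) *\<^sub>R radial_avg m g s) /\<^sub>R s) (at s)"
proof -
  define H where "H \<rho> = (2 * \<rho> ^ m) *\<^sub>R g (\<rho>\<^sup>2)" for \<rho>
  define G where "G r = integral {0..r} H" for r
  have Hc: "continuous_on {0..r} H" for r
    unfolding H_def[abs_def] by (intro continuous_intros continuous_on_compose2[OF g]) auto
  have eq: "radial_avg m g u = inverse (sqrt u ^ Suc m) *\<^sub>R G (sqrt u)" if u: "u > 0" for u
  proof -
    define r where "r = sqrt u"
    have r: "r > 0" "u = r\<^sup>2" using u by (auto simp: r_def)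
    have "(H has_integral G r) {0..r}"
      unfolding G_def by (intro integrable_integral integrable_continuous_real Hc)
    from has_integral_stretch_real[OF this, of r]
    have "((\<lambda>\<eta>. H (r * \<eta>)) has_integral (1 / r) *\<^sub>R G r) {0..1}"
      using r by (simp add: image_divide_atLeastAtMost)
    then have "((\<lambda>\<eta>. inverse (r ^ m) *\<^sub>R H (r * \<eta>)) has_integral inverse (r ^ m) *\<^sub>R (1 / r) *\<^sub>R G r) {0..1}"
      by (rule has_integral_cmul)
    moreover have "inverse (r ^ m) *\<^sub>R H (r * \<eta>) = (2 * \<eta> ^ m) *\<^sub>R g (u * \<eta>\<^sup>2)" for \<eta>
      using r by (simp add: H_def power_mult_distrib)
    ultimately have "radial_avg m g u = inverse (r ^ m) *\<^sub>R (1 / r) *\<^sub>R G r"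
      unfolding radial_avg_def by (simp add: integral_unique)
    then show ?thesis by (simp add: r_def divide_inverse mult.commute)
  qed
  define r where "r = sqrt s"
  have r: "r > 0" "s = r\<^sup>2" using s by (auto simp: r_def)
  have "(G has_vector_derivative H r) (at r within {0..r+1})"
    unfolding G_def[abs_def] using r Hc by (intro integral_has_vector_derivative) auto
  then have G': "(G has_vector_derivative H r) (at r)"
    using r by (subst (asm) at_within_interior) auto
  have sq: "(sqrt has_real_derivative inverse r / 2) (at s)"
    using DERIV_real_sqrt[OF s] by (simp add: r_def)
  then have "((G \<circ> sqrt) has_vector_derivative (inverse r / 2) *\<^sub>R H r) (at s)"
    using G' by (intro vector_diff_chain_at) (auto simp: r_def has_real_derivative_iff_has_vector_derivative)
  moreover have "((\<lambda>u. inverse (sqrt u ^ Suc m)) has_real_derivative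
      - (real (Suc m) * r ^ m * (inverse r / 2)) * inverse (r ^ Suc m) ^ 2) (at s)"
  proof -
    have "((\<lambda>x. inverse (x ^ Suc m)) has_real_derivative
        - (inverse (r ^ Suc m) * (real (Suc m) * r ^ m) * inverse (r ^ Suc m))) (at r)"
      using DERIV_inverse'[OF DERIV_pow[of "Suc m" r]] r by simp
    from DERIV_chain2[OF this[unfolded r_def] sq] show ?thesis
      by (rule DERIV_cong) (simp only: r_def[symmetric] power2_eq_square mult_ac minus_mult_left minus_mult_right)
  qed
  ultimately have "((\<lambda>u. inverse (sqrt u ^ Suc m) *\<^sub>R (G \<circ> sqrt) u) has_vector_derivative
      inverse (sqrt s ^ Suc m) *\<^sub>R ((inverse r / 2) *\<^sub>R H r) +
      (- (real (Suc m) * r ^ m * (inverse r / 2)) * inverse (r ^ Suc m) ^ 2) *\<^sub>R (G \<circ> sqrt) s) (at s)"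
    by (intro has_vector_derivative_scaleR)
  moreover have "inverse (sqrt s ^ Suc m) *\<^sub>R ((inverse r / 2) *\<^sub>R H r) +
      (- (real (Suc m) * r ^ m * (inverse r / 2)) * inverse (r ^ Suc m) ^ 2) *\<^sub>R (G \<circ> sqrt) s
      = (g s - (real (Suc m) / 2) *\<^sub>R radial_avg m g s) /\<^sub>R s"
  proof -
    have "inverse (r ^ Suc m) * (inverse r / 2) * (2 * r ^ m) = inverse s"
      using r by (simp add: field_simps power2_eq_square)
    moreover have "(real (Suc m) * r ^ m * (inverse r / 2)) * inverse (r ^ Suc m) ^ 2
       = inverse s * (real (Suc m) / 2) * inverse (r ^ Suc m)"
      using r by (simp add: field_simps power2_eq_square)
    ultimately show ?thesis
      using eq[OF s] r by (simp add: H_def r_def[symmetric] scaleR_diff_right del: power_Suc)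
  qed
  ultimately have "((\<lambda>u. inverse (sqrt u ^ Suc m) *\<^sub>R (G \<circ> sqrt) u) has_vector_derivative
      (g s - (real (Suc m) / 2) *\<^sub>R radial_avg m g s) /\<^sub>R s) (at s)" by metis
  then show ?thesis
    by (rule has_vector_derivative_transform_within_open[where S="{0<..}"]) (use s eq in auto)
qed

text \<open>With \<open>s = r\<^sup>2\<close> the profile equation becomes the first order system
  \<open>4 q' = - \<i> q + v\<close>, \<open>s v' = (\<i> b\<^sub>0 - h) q - (d/2) v\<close>; the real potential \<open>h\<close> stands for \<open>|q|\<^bsup>2\<sigma>\<^esup>\<close>.\<close>

locale radial_profile =
  fixes d b\<^sub>0 :: real and h :: "real \<Rightarrow> real" and q v :: "real \<Rightarrow> complex"
  assumes d: "d \<ge> 1"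
    and q_deriv: "s \<ge> 0 \<Longrightarrow> (q has_vector_derivative (- \<i> * q s + v s) / 4) (at s within {0..})"
    and v_deriv: "s > 0 \<Longrightarrow> (v has_vector_derivative
       ((\<i> * b\<^sub>0 - h s) * q s - (d / 2) * v s) / s) (at s)"
    and v_cont: "continuous_on {0..} v"
begin

lemma q_cont: "continuous_on {0..} q"
  using q_deriv by (auto simp: continuous_on_eq_continuous_within intro: has_vector_derivative_continuous)

text \<open>Passing to real and imaginary parts makes the momentum and energy identities below
  rational identities in real variables.\<close>

lemma component_derivs:
  assumes s: "s > 0"
  shows "((\<lambda>s. Re (q s)) has_real_derivative (Im (q s) + Re (v s)) / 4) (at s)"
    "((\<lambda>s. Im (q s)) has_real_derivative (Im (v s) - Re (q s)) / 4) (at s)"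
    "((\<lambda>s. Re (v s)) has_real_derivative (- b\<^sub>0 * Im (q s) - h s * Re (q s) - (d / 2) * Re (v s)) / s) (at s)"
    "((\<lambda>s. Im (v s)) has_real_derivative (b\<^sub>0 * Re (q s) - h s * Im (q s) - (d / 2) * Im (v s)) / s) (at s)"
proof -
  have "(q has_vector_derivative (- \<i> * q s + v s) / 4) (at s)"
    using q_deriv[of s] s at_within_interior[of s "{0..}"] interior_real_atLeast[of 0] by simp
  then show "((\<lambda>s. Re (q s)) has_real_derivative (Im (q s) + Re (v s)) / 4) (at s)"
    "((\<lambda>s. Im (q s)) has_real_derivative (Im (v s) - Re (q s)) / 4) (at s)"
    by (simp_all add: has_vector_derivative_complex_iff add.commute)
  show "((\<lambda>s. Re (v s)) has_real_derivative (- b\<^sub>0 * Im (q s) - h s * Re (q s) - (d / 2) * Re (v s)) / s) (at s)"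
    "((\<lambda>s. Im (v s)) has_real_derivative (b\<^sub>0 * Re (q s) - h s * Im (q s) - (d / 2) * Im (v s)) / s) (at s)"
    using v_deriv[OF s] by (auto simp: has_vector_derivative_complex_iff algebra_simps)
qed

text \<open>The angular momentum \<open>D = s\<^bsup>d/2\<^esup> (Im (cnj q v) - |q|\<^sup>2/2)\<close> vanishes at the origin and at zeros of \<open>q\<close>, while
  \<open>D' = s\<^bsup>d/2-1\<^esup> (b\<^sub>0 - d/4) |q|\<^sup>2\<close>; so a zero of \<open>q\<close> would be preceded by a smaller one. The sign
  \<open>b\<^sub>0 < d/4\<close> is the subcriticality condition \<open>\<sigma> d < 2\<close>.\<close>

lemma q_nonzero:
  assumes b0: "b\<^sub>0 < d / 4" and q0: "q 0 \<noteq> 0" and s: "s \<ge> 0"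
  shows "q s \<noteq> 0"
proof
  assume "q s = 0"
  define Z where "Z = {0..s} \<inter> q -` {0}"
  have "closed Z"
    unfolding Z_def by (intro continuous_closed_preimage continuous_on_subset[OF q_cont]) auto
  moreover have "bounded Z" unfolding Z_def by (rule bounded_subset[OF bounded_closed_interval[of 0 s]]) auto
  ultimately have "compact Z" by (simp add: compact_eq_bounded_closed)
  moreover have "s \<in> Z" using s \<open>q s = 0\<close> by (simp add: Z_def)
  ultimately obtain s0 where s0: "s0 \<in> Z" "\<And>t. t \<in> Z \<Longrightarrow> s0 \<le> t"
    using compact_attains_inf[of Z] by blast
  then have s0': "s0 > 0" "q s0 = 0" using q0 by (auto simp: Z_def order_less_le)
  define a b c e where "a s = Re (q s)" and "b s = Im (q s)" and "c s = Re (v s)" and "e s = Im (v s)" for s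
  define J where "J t = a t * e t - b t * c t - ((a t)\<^sup>2 + (b t)\<^sup>2) / 2" for t
  define D where "D t = t powr (d / 2) * J t" for t
  have der: "(D has_real_derivative t powr (d / 2 - 1) * ((b\<^sub>0 - d / 4) * ((a t)\<^sup>2 + (b t)\<^sup>2))) (at t)"
    if t: "t > 0" for t
  proof -
    note cd = component_derivs[OF t, folded a_def b_def c_def e_def]
    define A' B' C' E' where "A' = (b t + c t) / 4" and "B' = (e t - a t) / 4"
      and "C' = (- b\<^sub>0 * b t - h t * a t - (d / 2) * c t) / t" and "E' = (b\<^sub>0 * a t - h t * b t - (d / 2) * e t) / t"
    note ders = cd[folded A'_def B'_def C'_def E'_def]
    have J': "(J has_real_derivative A' * e t + a t * E' - (B' * c t + b t * C') - (a t * A' + b t * B')) (at t)"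
      unfolding J_def[abs_def] by (auto intro!: derivative_eq_intros ders simp: add_divide_distrib)
    have "((\<lambda>t. t powr (d / 2)) has_real_derivative (d / 2) * t powr (d / 2 - 1)) (at t)"
      using t by (auto intro!: derivative_eq_intros)
    from DERIV_mult[OF this J'] have "(D has_real_derivative (d / 2) * t powr (d / 2 - 1) * J t +
       (A' * e t + a t * E' - (B' * c t + b t * C') - (a t * A' + b t * B')) * t powr (d / 2)) (at t)"
      unfolding D_def[abs_def] .
    moreover have p: "t powr (d / 2) = t powr (d / 2 - 1) * t" using t by (simp add: powr_diff)
    \<comment> \<open>The potential \<open>h\<close> cancels because it is real, and so do all
      products of components of \<open>q\<close> and \<open>v\<close>; only |q|^2 survives.\<close>
    have "(d / 2) * J t + (A' * e t + a t * E' - (B' * c t + b t * C') - (a t * A' + b t * B')) * t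
        = (b\<^sub>0 - d / 4) * ((a t)\<^sup>2 + (b t)\<^sup>2)"
      using t by (simp add: J_def A'_def B'_def C'_def E'_def field_simps power2_eq_square)
    from this[symmetric] have "t powr (d / 2 - 1) * ((b\<^sub>0 - d / 4) * ((a t)\<^sup>2 + (b t)\<^sup>2)) =
        (d / 2) * t powr (d / 2 - 1) * J t +
        (A' * e t + a t * E' - (B' * c t + b t * C') - (a t * A' + b t * B')) * t powr (d / 2)"
      unfolding p by (simp only: distrib_left mult_ac)
    ultimately show ?thesis by simp
  qed
  have "continuous_on {0..s0} D"
    unfolding D_def[abs_def] J_def[abs_def] a_def b_def c_def e_def using d
    by (intro continuous_intros continuous_on_powr' continuous_on_subset[OF q_cont] continuous_on_subset[OF v_cont]) auto
  then obtain l z where z: "0 < z" "z < s0" "(D has_real_derivative l) (at z)" "D s0 - D 0 = (s0 - 0) * l"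
    using MVT[OF s0'(1), of D] der real_differentiable_def by blast
  then have "l = z powr (d / 2 - 1) * ((b\<^sub>0 - d / 4) * ((a z)\<^sup>2 + (b z)\<^sup>2))"
    using der DERIV_unique by blast
  \<comment> \<open>\<open>D\<close> vanishes at 0 because \<open>0 powr (d / 2) = 0\<close>, and at
    \<open>s0\<close> because every term of \<open>J\<close> contains a component of
    \<open>q\<close>.\<close>
  moreover have "l = 0" using z s0' by (simp add: D_def J_def a_def b_def)
  ultimately have "(a z)\<^sup>2 + (b z)\<^sup>2 = 0" using z b0 by auto
  then have "q z = 0" by (simp add: complex_eq_iff sum_power2_eq_zero_iff a_def b_def)
  then have "z \<in> Z" using z s0 by (auto simp: Z_def)
  then show False using s0(2) z by fastforce
qed

text \<open>In terms of \<open>z = q + \<i> v\<close>, which oscillates like \<open>exp (- \<i> s / 4)\<close>, and the slow mode \<open>v\<close>, the energy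
  \<open>Y = |z|\<^sup>2 + |v|\<^sup>2\<close> satisfies \<open>s Y' = - 2 b\<^sub>0 |z|\<^sup>2 - 2 \<kappa> |v|\<^sup>2 + d Im (cnj z v) + O(h Y)\<close>. The oscillating cross term is
  removed by adding the lower order correction \<open>(4 d / s) Re (cnj z v)\<close>.\<close>

lemma q_decay:
  fixes \<kappa> b \<epsilon> S :: real
  assumes \<kappa>: "d / 2 = \<kappa> + b\<^sub>0" "b\<^sub>0 \<le> \<kappa>" and b: "0 < b" "b < 2 * b\<^sub>0"
    and h: "\<And>s. s > 0 \<Longrightarrow> 0 \<le> h s \<and> h s \<le> (2 * b\<^sub>0 - b) / 4"
    and S: "S \<ge> 4 * d" "S \<ge> 2 * (d * (d + 2) + 2 * d * b) / (2 * b\<^sub>0 - b)"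
    and s: "s \<ge> S"
  shows "(cmod (q s))\<^sup>2 \<le> (S / s) powr b * (12 * (cmod (q S))\<^sup>2 + 18 * (cmod (v S))\<^sup>2)"
proof -
  have S0: "S > 0" using S(1) d by simp
  define a c e where "a s = Re (q s)" and "c s = Re (v s)" and "e s = Im (v s)" for s
  define p where "p s = Im (q s)" for s
  define Y where "Y t = (a t - e t)\<^sup>2 + (p t + c t)\<^sup>2 + ((c t)\<^sup>2 + (e t)\<^sup>2)" for t
  define R where "R t = a t * c t + p t * e t" for t
  define \<Phi> where "\<Phi> t = Y t + (4 * d / t) * R t" for t
  have R: "\<bar>R t\<bar> \<le> Y t / 2" for t
  proof -
    have "Y t - 2 * R t = (a t - e t - c t)\<^sup>2 + (p t + c t - e t)\<^sup>2"
      "Y t + 2 * R t = (a t - e t + c t)\<^sup>2 + (p t + c t + e t)\<^sup>2"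
      by (auto simp: Y_def R_def power2_eq_square algebra_simps)
    then have "0 \<le> Y t - 2 * R t" "0 \<le> Y t + 2 * R t" by auto
    then show ?thesis by linarith
  qed
  have Y0: "Y t \<ge> 0" for t by (simp add: Y_def)
  have n: "(cmod (q t))\<^sup>2 = (a t)\<^sup>2 + (p t)\<^sup>2" "(cmod (v t))\<^sup>2 = (c t)\<^sup>2 + (e t)\<^sup>2" for t
    by (simp_all add: cmod_power2 a_def p_def c_def e_def)
  have nY: "(cmod (q t))\<^sup>2 \<le> 2 * Y t" for t
  proof -
    have "2 * Y t - ((a t)\<^sup>2 + (p t)\<^sup>2) = (a t - 2 * e t)\<^sup>2 + (p t + 2 * c t)\<^sup>2"
      by (simp add: Y_def power2_eq_square algebra_simps)
    then show ?thesis unfolding n by (smt (verit) zero_le_power2)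
  qed
  have Yn: "Y t \<le> 2 * (cmod (q t))\<^sup>2 + 3 * (cmod (v t))\<^sup>2" for t
  proof -
    have "2 * ((a t)\<^sup>2 + (p t)\<^sup>2) + 3 * ((c t)\<^sup>2 + (e t)\<^sup>2) - Y t = (a t + e t)\<^sup>2 + (p t - c t)\<^sup>2"
      by (simp add: Y_def power2_eq_square algebra_simps)
    then show ?thesis unfolding n by (smt (verit) zero_le_power2)
  qed
  have R4: "\<bar>(4 * d / t) * R t\<bar> \<le> (2 * d / t) * Y t" if t: "t > 0" for t
  proof -
    have "\<bar>(4 * d / t) * R t\<bar> = (4 * d / t) * \<bar>R t\<bar>" using t d by (simp add: abs_mult)
    also have "\<dots> \<le> (4 * d / t) * (Y t / 2)" using t d R by (intro mult_left_mono) auto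
    finally show ?thesis by simp
  qed
  \<comment> \<open>The first lower bound on \<open>S\<close> enters here: the correction costs at
    most half of \<open>Y\<close>, so \<open>\<Phi>\<close> and \<open>Y\<close> are comparable from
    \<open>S\<close> on.\<close>
  have half: "(2 * d / t) * Y t \<le> Y t / 2" if "t \<ge> S" for t
  proof -
    have "2 * d / t \<le> 1 / 2" using that S S0 by (simp add: field_simps)
    from mult_right_mono[OF this Y0] show ?thesis by simp
  qed
  have \<Phi>1: "Y t \<le> 2 * \<Phi> t \<and> \<Phi> t \<le> 3 / 2 * Y t" if "t \<ge> S" for t
  proof -
    define X where "X = (4 * d / t) * R t"
    have "\<bar>X\<bar> \<le> (2 * d / t) * Y t" unfolding X_def using that S0 by (intro R4) simp
    then have "\<bar>X\<bar> \<le> Y t / 2" using half[OF that] by (rule order_trans)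
    moreover have "\<Phi> t = Y t + X" by (simp add: \<Phi>_def X_def)
    ultimately show ?thesis by (auto simp: abs_le_iff)
  qed
  \<comment> \<open>Decay of \<open>\<Phi>\<close> like \<open>t powr (- b)\<close> follows once
    \<open>G\<close> is nonincreasing.\<close>
  define G where "G t = t powr b * \<Phi> t" for t
  have der: "\<exists>y. (G has_real_derivative y) (at t) \<and> y \<le> 0" if t: "t \<ge> S" for t
  proof -
    have t0: "t > 0" using t S0 by simp
    note cd = component_derivs[OF t0, folded a_def p_def c_def e_def]
    define A' P' C' E' where "A' = (p t + c t) / 4" and "P' = (e t - a t) / 4"
      and "C' = (- b\<^sub>0 * p t - h t * a t - (d / 2) * c t) / t" and "E' = (b\<^sub>0 * a t - h t * p t - (d / 2) * e t) / t"
    note ders = cd[folded A'_def P'_def C'_def E'_def]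
    define Y' where "Y' = 2 * (a t - e t) * (A' - E') + 2 * (p t + c t) * (P' + C') + (2 * c t * C' + 2 * e t * E')"
    define R' where "R' = A' * c t + a t * C' + (P' * e t + p t * E')"
    have Y': "(Y has_real_derivative Y') (at t)"
      unfolding Y_def[abs_def] Y'_def by (auto intro!: derivative_eq_intros ders simp: algebra_simps)
    have R': "(R has_real_derivative R') (at t)"
      unfolding R_def[abs_def] R'_def by (auto intro!: derivative_eq_intros ders)
    have "((\<lambda>t. 4 * d / t) has_real_derivative - (4 * d / t\<^sup>2)) (at t)"
      using t0 by (auto intro!: derivative_eq_intros simp: power2_eq_square)
    from DERIV_add[OF Y' DERIV_mult[OF this R']]
    have \<Phi>': "(\<Phi> has_real_derivative Y' + (- (4 * d / t\<^sup>2) * R t + R' * (4 * d / t))) (at t)"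
      unfolding \<Phi>_def[abs_def] .
    define \<Phi>' where "\<Phi>' = Y' + (- (4 * d / t\<^sup>2) * R t + R' * (4 * d / t))"
    have "((\<lambda>t. t powr b) has_real_derivative b * t powr (b - 1)) (at t)"
      using t0 by (auto intro!: derivative_eq_intros)
    from DERIV_mult[OF this \<Phi>'[folded \<Phi>'_def]]
    have G': "(G has_real_derivative b * t powr (b - 1) * \<Phi> t + \<Phi>' * t powr b) (at t)"
      unfolding G_def[abs_def] .
    have eq: "b * t powr (b - 1) * \<Phi> t + \<Phi>' * t powr b = t powr (b - 1) * (b * \<Phi> t + t * \<Phi>')"
      using t0 by (simp add: powr_diff field_simps)
    have tY': "t * Y' = - 2 * b\<^sub>0 * ((a t - e t)\<^sup>2 + (p t + c t)\<^sup>2) - 2 * \<kappa> * ((c t)\<^sup>2 + (e t)\<^sup>2)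
        + d * ((a t - e t) * e t - (p t + c t) * c t) - 4 * h t * R t"
    proof -
      have "d = 2 * (\<kappa> + b\<^sub>0)" using \<kappa> by simp
      then show ?thesis
        using t0 by (simp add: Y'_def R_def A'_def P'_def C'_def E'_def field_simps power2_eq_square)
    qed
    \<comment> \<open>Multiplied by \<open>4 * d / t\<close>, the first term cancels the cross term
      with factor \<open>d\<close> in \<open>tY'\<close>. The rest is of order 1/t, or nonpositive
      because \<open>h\<close> is nonnegative.\<close>
    have tR': "t * R' = - (t / 4) * ((a t - e t) * e t - (p t + c t) * c t) - (d / 2) * R t - h t * ((a t)\<^sup>2 + (p t)\<^sup>2)"
      using t0 by (simp add: R'_def R_def A'_def P'_def C'_def E'_def field_simps power2_eq_square)
    have "t * \<Phi>' = t * Y' - (4 * d / t) * R t + (4 * d / t) * (t * R')"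
      using t0 by (simp add: \<Phi>'_def field_simps power2_eq_square)
    also have "\<dots> = - 2 * b\<^sub>0 * ((a t - e t)\<^sup>2 + (p t + c t)\<^sup>2) - 2 * \<kappa> * ((c t)\<^sup>2 + (e t)\<^sup>2)
        - 4 * h t * R t - (d / 2 + 1) * ((4 * d / t) * R t) - (4 * d / t) * (h t * ((a t)\<^sup>2 + (p t)\<^sup>2))"
      unfolding tY' tR' using t0 by (simp add: field_simps)
    also have "\<dots> \<le> - 2 * b\<^sub>0 * Y t + (2 * b\<^sub>0 - b) / 2 * Y t + (d / 2 + 1) * ((2 * d / t) * Y t) - 0"
    proof (intro diff_mono add_mono)
      have k1: "2 * b\<^sub>0 * ((c t)\<^sup>2 + (e t)\<^sup>2) \<le> 2 * \<kappa> * ((c t)\<^sup>2 + (e t)\<^sup>2)"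
        using \<kappa> by (intro mult_right_mono) auto
      \<comment> \<open>The gap \<open>2 * b\<^sub>0 - b\<close> is the whole budget. Half is spent
        on the potential here, the other half on the terms of order 1/t in fact \<open>3\<close>,
        which accounts for the second lower bound on \<open>S\<close>.\<close>
      have k2: "- 4 * h t * R t \<le> (2 * b\<^sub>0 - b) / 2 * Y t"
      proof -
        have "(4 * h t) * (- R t) \<le> (4 * h t) * \<bar>R t\<bar>" using h[OF t0] by (intro mult_left_mono) auto
        then have "- 4 * h t * R t \<le> 4 * h t * \<bar>R t\<bar>" by simp
        also have "\<dots> \<le> 4 * ((2 * b\<^sub>0 - b) / 4) * (Y t / 2)" using h[OF t0] R by (intro mult_mono) auto
        also have "\<dots> = (2 * b\<^sub>0 - b) / 2 * Y t" by (simp add: field_simps)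
        finally show ?thesis .
      qed
      have k3: "- ((d / 2 + 1) * ((4 * d / t) * R t)) \<le> (d / 2 + 1) * ((2 * d / t) * Y t)"
      proof -
        have "- ((4 * d / t) * R t) \<le> (2 * d / t) * Y t" using R4[OF t0] by (rule abs_le_D2)
        from mult_left_mono[OF this, of "d / 2 + 1"] d show ?thesis unfolding mult_minus_right by simp
      qed
      show "- 2 * b\<^sub>0 * ((a t - e t)\<^sup>2 + (p t + c t)\<^sup>2) - 2 * \<kappa> * ((c t)\<^sup>2 + (e t)\<^sup>2)
        - 4 * h t * R t - (d / 2 + 1) * ((4 * d / t) * R t)
        \<le> - 2 * b\<^sub>0 * Y t + (2 * b\<^sub>0 - b) / 2 * Y t + (d / 2 + 1) * ((2 * d / t) * Y t)"
      proof -
        have "2 * b\<^sub>0 * Y t = 2 * b\<^sub>0 * ((a t - e t)\<^sup>2 + (p t + c t)\<^sup>2) + 2 * b\<^sub>0 * ((c t)\<^sup>2 + (e t)\<^sup>2)"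
          by (simp only: Y_def distrib_left)
        with k1 k2 k3 show ?thesis by linarith
      qed
      show "0 \<le> (4 * d / t) * (h t * ((a t)\<^sup>2 + (p t)\<^sup>2))" using h[OF t0] t0 d by simp
    qed
    finally have 1: "t * \<Phi>' \<le> - 2 * b\<^sub>0 * Y t + (2 * b\<^sub>0 - b) / 2 * Y t + (d / 2 + 1) * ((2 * d / t) * Y t)"
      by simp
    have "\<Phi> t \<le> Y t + (2 * d / t) * Y t" using abs_le_D1[OF R4[OF t0]] by (simp add: \<Phi>_def)
    then have 2: "b * \<Phi> t \<le> b * (Y t + (2 * d / t) * Y t)" using b(1) by (intro mult_left_mono) auto
    have 3: "(d * (d + 2) + 2 * d * b) / t \<le> (2 * b\<^sub>0 - b) / 2"
    proof -
      have "2 * (d * (d + 2) + 2 * d * b) / (2 * b\<^sub>0 - b) \<le> t" using S(2) t by (rule order_trans)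
      then have "2 * (d * (d + 2) + 2 * d * b) \<le> t * (2 * b\<^sub>0 - b)"
        using b by (simp only: pos_divide_le_eq)
      then show ?thesis using t0 by (simp add: pos_divide_le_eq mult.commute)
    qed
    have "b * \<Phi> t + t * \<Phi>' \<le> b * (Y t + (2 * d / t) * Y t) +
        (- 2 * b\<^sub>0 * Y t + (2 * b\<^sub>0 - b) / 2 * Y t + (d / 2 + 1) * ((2 * d / t) * Y t))"
      using 1 2 by (rule add_mono[rotated])
    also have "\<dots> = ((d * (d + 2) + 2 * d * b) / t - (2 * b\<^sub>0 - b) / 2) * Y t"
      using t0 by (simp add: field_simps)
    also have "\<dots> \<le> 0" using 3 Y0[of t] by (intro mult_nonpos_nonneg) auto
    finally have "t powr (b - 1) * (b * \<Phi> t + t * \<Phi>') \<le> 0" by (intro mult_nonneg_nonpos) auto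
    then show ?thesis using G' unfolding eq by blast
  qed
  have "G s \<le> G S"
    by (rule DERIV_nonpos_imp_nonincreasing[OF s]) (use der in auto)
  then have "\<Phi> s \<le> (S / s) powr b * \<Phi> S"
    using S0 s by (simp add: G_def powr_divide field_simps)
  also have "\<dots> \<le> (S / s) powr b * (3 / 2 * (2 * (cmod (q S))\<^sup>2 + 3 * (cmod (v S))\<^sup>2))"
    using \<Phi>1[of S] Yn[of S] by (intro mult_left_mono) auto
  \<comment> \<open>From |q|^2 <= 2 Y <= 4 \<Phi>, and \<Phi> <= 3/2 Y at \<open>S\<close>, the
    weights 2 and 3 of \<open>Yn\<close> are multiplied by 6, hence 12 and 18.\<close>
  finally show ?thesis using nY[of s] \<Phi>1[OF s] by (simp add: algebra_simps)
qed

end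

section \<open>Existence of small profiles\<close>

text \<open>The truncation makes the nonlinearity globally Lipschitz, as the fixed point argument
  requires. The difference of the two coefficients is always paired with the argument of smaller
  modulus.\<close>

lemma truncated_power_lipschitz:
  fixes \<sigma> \<delta> :: real and z w :: complex
  assumes \<sigma>: "\<sigma> > 0" and \<delta>: "\<delta> > 0"
  shows "cmod ((min (cmod z) \<delta> powr (2 * \<sigma>)) *\<^sub>R z - (min (cmod w) \<delta> powr (2 * \<sigma>)) *\<^sub>R w)
    \<le> (2 * \<sigma> + 1) * \<delta> powr (2 * \<sigma>) * cmod (z - w)"
proof -
  define g where "g z = min (cmod z) \<delta> powr (2 * \<sigma>)" for z :: complex
  have g\<delta>: "g z \<le> \<delta> powr (2 * \<sigma>)" for z
    unfolding g_def using \<sigma> \<delta> by (intro powr_mono2) auto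
  have *: "(g w - g z) * cmod z \<le> 2 * \<sigma> * \<delta> powr (2 * \<sigma>) * (cmod w - cmod z)" if le: "cmod z \<le> cmod w" for z w :: complex
  proof (cases "cmod z = 0 \<or> cmod z \<ge> \<delta> \<or> cmod z = cmod w")
    case True
    then show ?thesis using le \<sigma> \<delta> by (auto simp: g_def)
  next
    case False
    define x y where "x = cmod z" and "y = min (cmod w) \<delta>"
    have xy: "0 < x" "x < y" "y \<le> \<delta>" "y \<le> cmod w" using False le by (auto simp: x_def y_def)
    have "\<exists>\<xi>. x < \<xi> \<and> \<xi> < y \<and> y powr (2 * \<sigma>) - x powr (2 * \<sigma>) = (y - x) * (2 * \<sigma> * \<xi> powr (2 * \<sigma> - 1))"
      using xy by (intro MVT2) (auto intro!: derivative_eq_intros)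
    then obtain \<xi> where \<xi>: "x < \<xi>" "\<xi> < y" "y powr (2 * \<sigma>) - x powr (2 * \<sigma>) = (y - x) * (2 * \<sigma> * \<xi> powr (2 * \<sigma> - 1))"
      by blast
    \<comment> \<open>If \<open>2 * \<sigma> < 1\<close>, the derivative of the power is unbounded
      near 0; the factor \<open>x\<close>, smaller than \<open>\<xi>\<close>, restores the missing
      power.\<close>
    have "(y powr (2 * \<sigma>) - x powr (2 * \<sigma>)) * x = (y - x) * (2 * \<sigma>) * (\<xi> powr (2 * \<sigma> - 1) * x)"
      unfolding \<xi>(3) by simp
    also have "\<dots> \<le> (y - x) * (2 * \<sigma>) * (\<xi> powr (2 * \<sigma> - 1) * \<xi>)"
      using xy \<xi> \<sigma> by (intro mult_left_mono) auto
    also have "\<xi> powr (2 * \<sigma> - 1) * \<xi> = \<xi> powr (2 * \<sigma>)" using xy \<xi> by (simp add: powr_diff)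
    also have "(y - x) * (2 * \<sigma>) * \<xi> powr (2 * \<sigma>) \<le> (cmod w - x) * (2 * \<sigma>) * \<delta> powr (2 * \<sigma>)"
      using xy \<xi> \<sigma> by (intro mult_mono powr_mono2) auto
    also have "\<dots> = 2 * \<sigma> * \<delta> powr (2 * \<sigma>) * (cmod w - cmod z)" by (simp add: x_def)
    moreover have "g w = y powr (2 * \<sigma>)" "g z = x powr (2 * \<sigma>)" using xy by (simp_all add: g_def x_def y_def)
    ultimately show ?thesis by (simp only: x_def)
  qed
  have **: "cmod (g z *\<^sub>R z - g w *\<^sub>R w) \<le> (2 * \<sigma> + 1) * \<delta> powr (2 * \<sigma>) * cmod (z - w)"
    if le: "cmod z \<le> cmod w" for z w :: complex
  proof -
    have mono: "g z \<le> g w" unfolding g_def using \<sigma> \<delta> le by (intro powr_mono2) auto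
    have "g z *\<^sub>R z - g w *\<^sub>R w = g w *\<^sub>R (z - w) - (g w - g z) *\<^sub>R z" by (simp add: algebra_simps)
    then have "cmod (g z *\<^sub>R z - g w *\<^sub>R w) \<le> cmod (g w *\<^sub>R (z - w)) + cmod ((g w - g z) *\<^sub>R z)"
      by (metis norm_triangle_ineq4)
    also have "\<dots> = g w * cmod (z - w) + (g w - g z) * cmod z"
      using mono by (simp add: g_def)
    also have "\<dots> \<le> \<delta> powr (2 * \<sigma>) * cmod (z - w) + 2 * \<sigma> * \<delta> powr (2 * \<sigma>) * (cmod w - cmod z)"
      by (intro add_mono mult_right_mono g\<delta> * le) auto
    also have "\<dots> \<le> \<delta> powr (2 * \<sigma>) * cmod (z - w) + 2 * \<sigma> * \<delta> powr (2 * \<sigma>) * cmod (z - w)"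
      using \<sigma> norm_triangle_ineq2[of w z] by (intro add_left_mono mult_left_mono) (auto simp: norm_minus_commute)
    finally show ?thesis by (simp add: algebra_simps)
  qed
  show ?thesis
  proof (cases "cmod z \<le> cmod w")
    case True
    then show ?thesis using **[of z w] by (simp add: g_def)
  next
    case False
    then show ?thesis using **[of w z] by (simp add: g_def norm_minus_commute)
  qed
qed

text \<open>At \<open>s = 0\<close> the equation for \<open>v\<close> degenerates to an algebraic
  relation, and this is the value that satisfies it.\<close>

lemma radial_avg_at_0: "radial_avg m g 0 = (2 / real (Suc m)) *\<^sub>R g 0"
proof -
  have "((\<lambda>\<eta>::real. 2 * \<eta> ^ m) has_integral 2 / real (Suc m) * 1 ^ Suc m - 2 / real (Suc m) * 0 ^ Suc m) {0..1}"
    by (intro fundamental_theorem_of_calculus)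
      (auto intro!: derivative_eq_intros simp: has_real_derivative_iff_has_vector_derivative[symmetric] simp del: power_Suc of_nat_Suc)
  then have "((\<lambda>\<eta>::real. 2 * \<eta> ^ m) has_integral 2 / real (Suc m)) {0..1}" by simp
  from has_integral_scaleR_left[OF this, of "g 0"] show ?thesis
    by (simp add: radial_avg_def integral_unique)
qed

text \<open>The limiting rate for |q|^2 in the variable \<open>s\<close> is
  \<open>real n - 1 / \<sigma>\<close>; a smaller \<open>b\<close> leaves room for a small potential
  and for corrections of order 1/s.\<close>

lemma self_similar_profile_exists:
  fixes \<sigma> b :: real and n :: nat
  assumes \<sigma>: "\<sigma> > 0" "1 < \<sigma> * real n" "\<sigma> * real n < 2" and b: "0 < b" "b < real n - 1 / \<sigma>"
  obtains q q1 q2 :: "real \<Rightarrow> complex" and C :: real where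
    "\<And>k. Ck_within k {0..} q"
    "\<And>s. s \<ge> 0 \<Longrightarrow> q s \<noteq> 0"
    "C > 0" "\<And>s. s \<ge> 0 \<Longrightarrow> (cmod (q s))\<^sup>2 \<le> C * (1 + s) powr (- b)"
    "\<And>s. s \<ge> 0 \<Longrightarrow> (q has_vector_derivative q1 s) (at s within {0..})"
    "\<And>s. s \<ge> 0 \<Longrightarrow> (q1 has_vector_derivative q2 s) (at s within {0..})"
    "\<And>s. s \<ge> 0 \<Longrightarrow> 4 * of_real s * q2 s + 2 * of_nat n * q1 s + \<i> * of_real s * q1 s + \<i> / of_real (2 * \<sigma>) * q s
        + complex_of_real (cmod (q s) powr (2 * \<sigma>)) * q s = 0"
proof -
  have n: "n \<ge> 1" using \<sigma> by (cases n) auto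
  define m where "m = n - 1"
  have m: "Suc m = n" using n by (simp add: m_def)
  define d where "d = real n"
  \<comment> \<open>In the variable \<open>s\<close> the two modes at infinity decay like
    \<open>s powr (- \<kappa>)\<close> and \<open>s powr (- b0)\<close>. The level
    \<open>\<delta>\<close> makes \<open>\<delta> powr (2 * \<sigma>)\<close> exactly the bound on
    the potential in \<open>q_decay\<close>.\<close>
  define \<kappa> b0 \<epsilon> \<delta> where "\<kappa> = 1 / (2 * \<sigma>)" and "b0 = (d - 1 / \<sigma>) / 2"
    and "\<epsilon> = (2 * b0 - b) / 4" and "\<delta> = \<epsilon> powr (1 / (2 * \<sigma>))"
  have d1: "d \<ge> 1" using n by (simp add: d_def)
  have \<kappa>: "d / 2 = \<kappa> + b0" by (simp add: \<kappa>_def b0_def field_simps)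
  have b0: "b0 < d / 4" using \<sigma> by (simp add: b0_def d_def field_simps)
  have \<kappa>b0: "b0 \<le> \<kappa>" using \<kappa> b0 by simp
  have b': "b < 2 * b0" using b by (simp add: b0_def d_def)
  have \<epsilon>: "\<epsilon> > 0" using b' by (simp add: \<epsilon>_def)
  have \<delta>: "\<delta> > 0" using \<epsilon> by (simp add: \<delta>_def)
  have \<delta>\<epsilon>: "\<delta> powr (2 * \<sigma>) = \<epsilon>" using \<sigma> \<epsilon> by (simp add: \<delta>_def powr_powr)
  define h0 where "h0 z = min (cmod z) \<delta> powr (2 * \<sigma>)" for z
  define N where "N z = (\<i> * b0 - h0 z) * z" for z :: complex
  define K where "K = b0 + (2 * \<sigma> + 1) * \<epsilon>"
  have K: "K > 0" using b b' \<sigma> \<epsilon> by (auto simp: K_def intro!: add_pos_pos)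
  have h0: "0 \<le> h0 z" "h0 z \<le> \<epsilon>" for z
    using powr_mono2[of "2 * \<sigma>" "min (cmod z) \<delta>" \<delta>] \<sigma> \<delta> by (auto simp: h0_def \<delta>\<epsilon>)
  have lip: "cmod (N z - N w) \<le> K * cmod (z - w)" for z w
  proof -
    have "N z - N w = \<i> * b0 * (z - w) - (h0 z *\<^sub>R z - h0 w *\<^sub>R w)"
      by (simp add: N_def algebra_simps scaleR_conv_of_real)
    then have "cmod (N z - N w) \<le> cmod (\<i> * b0 * (z - w)) + cmod (h0 z *\<^sub>R z - h0 w *\<^sub>R w)"
      by (metis norm_triangle_ineq4)
    also have "\<dots> \<le> b0 * cmod (z - w) + (2 * \<sigma> + 1) * \<epsilon> * cmod (z - w)"
      using truncated_power_lipschitz[OF \<sigma>(1) \<delta>, of z w] b b' by (simp add: h0_def \<delta>\<epsilon> norm_mult)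
    finally show ?thesis by (simp add: K_def algebra_simps)
  qed
  have N0: "N 0 = 0" by (simp add: N_def)
  define S where "S = max (4 * d) (2 * (d * (d + 2) + 2 * d * b) / (2 * b0 - b))"
  have S: "S \<ge> 4 * d" "S \<ge> 2 * (d * (d + 2) + 2 * d * b) / (2 * b0 - b)" by (auto simp: S_def)
  have S0: "S > 0" using S d1 by linarith
  \<comment> \<open>Relative to |q0|, \<open>B\<close> bounds |q| on [0, S] and
    \<open>2 * (K * B)\<close> bounds |v| at \<open>S\<close>; \<open>M\<close> inserts both into
    \<open>q_decay\<close>. None of them depends on \<open>q0\<close>, which may therefore be chosen
    afterwards.\<close>
  define B where "B = 2 * exp ((1 + 2 * K) / 2 * S)"
  define M where "M = sqrt (12 * B\<^sup>2 + 18 * (2 * (K * B))\<^sup>2)"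
  have B: "B > 0" by (simp add: B_def)
  have M2: "M\<^sup>2 = 12 * B\<^sup>2 + 18 * (2 * (K * B))\<^sup>2" by (simp add: M_def)
  have "B\<^sup>2 \<le> M\<^sup>2" unfolding M2 using zero_le_power2[of B] zero_le_power2[of "2 * (K * B)"] by linarith
  then have BM: "B \<le> M" by (rule power2_le_imp_le) (simp add: M_def)
  then have M: "M > 0" using B by linarith
  \<comment> \<open>All bounds on the truncated solution are linear in \<open>|q0|\<close>; this choice keeps \<open>|q| \<le> \<delta>\<close>, where the truncation is inactive.\<close>
  define q0 where "q0 = complex_of_real (\<delta> / M)"
  have q0: "cmod q0 = \<delta> / M" using \<delta> M by (simp add: q0_def norm_divide)
  obtain q where q: "continuous_on {0..} q" "q 0 = q0"
    "\<And>s. s \<ge> 0 \<Longrightarrow> (q has_vector_derivative (- \<i> * q s + radial_avg m (\<lambda>x. N (q x)) s) / 4) (at s within {0..})"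
    "\<And>s. s \<ge> 0 \<Longrightarrow> cmod (q s) \<le> 2 * cmod q0 * exp ((1 + 2 * K) / 2 * s)"
    using radial_profile_exists[OF lip N0, of q0 m] by blast
  define v where "v = radial_avg m (\<lambda>x. N (q x))"
  have "K-lipschitz_on UNIV N" using lip K by (auto simp: lipschitz_on_def dist_norm)
  then have "continuous_on UNIV N" by (rule lipschitz_on_continuous_on)
  then have Nq: "continuous_on {0..} (\<lambda>x. N (q x))"
    using q(1) by (rule continuous_on_compose2) auto
  have v_cont: "continuous_on {0..} v" unfolding v_def by (rule radial_avg_continuous[OF Nq])
  have v_deriv: "(v has_vector_derivative ((\<i> * b0 - h0 (q s)) * q s - (d / 2) * v s) / s) (at s)" if "s > 0" for s
    using radial_avg_has_vector_derivative[OF Nq that, of m] unfolding m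
    by (simp add: v_def N_def d_def scaleR_conv_of_real field_simps)
  interpret radial_profile d b0 "\<lambda>s. h0 (q s)" q v
    by unfold_locales (use d1 q(3) v_deriv v_cont in \<open>auto simp: v_def\<close>)
  have nz: "q s \<noteq> 0" if "s \<ge> 0" for s
    using q_nonzero[OF b0 _ that] q(2) \<delta> M by (simp add: q0_def)
  have qB: "cmod (q s) \<le> B * cmod q0" if "0 \<le> s" "s \<le> S" for s
  proof -
    have "exp ((1 + 2 * K) / 2 * s) \<le> exp ((1 + 2 * K) / 2 * S)" using that K by simp
    then have "2 * cmod q0 * exp ((1 + 2 * K) / 2 * s) \<le> 2 * cmod q0 * exp ((1 + 2 * K) / 2 * S)"
      by (intro mult_left_mono) auto
    then show ?thesis using q(4)[OF that(1)] by (simp add: B_def mult_ac)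
  qed
  have vB: "cmod (v S) \<le> 2 * (K * B) * cmod q0"
  proof -
    have "cmod (N (q u)) \<le> K * (B * cmod q0)" if "0 \<le> u" "u \<le> S" for u
    proof -
      have "cmod (N (q u)) \<le> K * cmod (q u)" using lip[of "q u" 0] by (simp add: N0)
      also have "\<dots> \<le> K * (B * cmod q0)" using K by (intro mult_left_mono qB that) auto
      finally show ?thesis .
    qed
    from radial_avg_bound[OF Nq _ this] S0 show ?thesis by (simp add: v_def mult_ac)
  qed
  \<comment> \<open>The quotient \<open>(1 + S) / (1 + s)\<close> serves both ranges: it is at least
    1 up to \<open>S\<close>, and beyond \<open>S\<close> it dominates \<open>S / s\<close>.\<close>
  have decay: "(cmod (q s))\<^sup>2 \<le> ((1 + S) / (1 + s)) powr b * \<delta>\<^sup>2" if s: "s \<ge> 0" for s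
  proof (cases "s \<le> S")
    case True
    have "cmod (q s) \<le> M * cmod q0"
      using qB[OF s True] mult_right_mono[OF BM norm_ge_zero[of q0]] by linarith
    then have "(cmod (q s))\<^sup>2 \<le> 1 * \<delta>\<^sup>2" using M by (simp add: q0 power_mono)
    also have "\<dots> \<le> ((1 + S) / (1 + s)) powr b * \<delta>\<^sup>2"
      using True s b by (intro mult_right_mono ge_one_powr_ge_zero) auto
    finally show ?thesis .
  next
    case False
    have "(cmod (q s))\<^sup>2 \<le> (S / s) powr b * (12 * (cmod (q S))\<^sup>2 + 18 * (cmod (v S))\<^sup>2)"
      using q_decay[OF \<kappa> \<kappa>b0 b(1) b' _ S] False h0 by (simp add: \<epsilon>_def)
    also have "\<dots> \<le> ((1 + S) / (1 + s)) powr b * (12 * (B * cmod q0)\<^sup>2 + 18 * (2 * (K * B) * cmod q0)\<^sup>2)"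
      using qB[of S] vB False S0 b by (intro mult_mono powr_mono2 add_mono power_mono) (auto simp: field_simps)
    also have "12 * (B * cmod q0)\<^sup>2 + 18 * (2 * (K * B) * cmod q0)\<^sup>2 = M\<^sup>2 * (cmod q0)\<^sup>2"
      unfolding M2 by (simp only: power_mult_distrib distrib_right mult.assoc)
    also have "\<dots> = \<delta>\<^sup>2" using M by (simp add: q0 power_divide)
    finally show ?thesis .
  qed
  have small: "cmod (q s) \<le> \<delta>" if s: "s \<ge> 0" for s
  proof (cases "s \<le> S")
    case True
    have "cmod (q s) \<le> M * cmod q0"
      using qB[OF s True] mult_right_mono[OF BM norm_ge_zero[of q0]] by linarith
    then show ?thesis using M by (simp add: q0)
  next
    case False
    have "((1 + S) / (1 + s)) powr b \<le> 1" using False S0 b by (intro powr_le1) auto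
    then have "((1 + S) / (1 + s)) powr b * \<delta>\<^sup>2 \<le> 1 * \<delta>\<^sup>2" by (intro mult_right_mono) auto
    then have "(cmod (q s))\<^sup>2 \<le> \<delta>\<^sup>2" using decay[OF s] by linarith
    then show ?thesis by (rule power2_le_imp_le) (use \<delta> in simp)
  qed
  have h0q: "h0 (q s) = cmod (q s) powr (2 * \<sigma>)" if "s \<ge> 0" for s
    using small[OF that] by (simp add: h0_def min_def)
  \<comment> \<open>Bootstrap: \<open>v\<close> is as smooth as \<open>q\<close>, and the derivative
    of \<open>q\<close> is a combination of both, so each round gains one derivative. The modulus
    enters through \<open>q s \<bullet> q s\<close>, which is smooth and positive.\<close>
  have smooth: "Ck_within k {0..} q \<and> Ck_within k {0..} v" for k
  proof -
    have step: "Ck_within k {0..} v" if "Ck_within k {0..} q" for k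
      unfolding v_def
    proof (rule Ck_within_radial_avg[OF Ck_within_cong])
      have "Ck_within k {0..} (\<lambda>s. (q s \<bullet> q s) powr \<sigma>)"
        using Ck_within_bilinear[OF bounded_bilinear_inner that that] nz
        by (intro Ck_within_compose[OF Ck_within_powr]) auto
      then show "Ck_within k {0..} (\<lambda>s. (\<i> * b0) * q s + (- 1) *\<^sub>R ((q s \<bullet> q s) powr \<sigma> *\<^sub>R q s))"
        by (intro Ck_within_add Ck_within_linear[OF bounded_linear_mult_right]
          Ck_within_linear[OF bounded_linear_scaleR_right] Ck_within_bilinear[OF bounded_bilinear_scaleR] that)
      fix s :: real assume s: "s \<in> {0..}"
      have "(q s \<bullet> q s) powr \<sigma> = cmod (q s) powr (2 * \<sigma>)"
        using nz[of s] s by (simp add: power2_norm_eq_inner[symmetric] powr_powr flip: powr_numeral)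
      then show "(\<i> * b0) * q s + (- 1) *\<^sub>R ((q s \<bullet> q s) powr \<sigma> *\<^sub>R q s) = N (q s)"
        using h0q[of s] s by (simp add: N_def scaleR_conv_of_real algebra_simps)
    qed
    have "Ck_within k {0..} q"
    proof (induction k)
      case 0
      then show ?case using q(1) by simp
    next
      case (Suc k)
      show ?case
      proof (rule Ck_within_vector_derivative_I)
        show "\<And>s. s \<in> {0..} \<Longrightarrow> (q has_vector_derivative (1/4) *\<^sub>R (- \<i> * q s + v s)) (at s within {0..})"
          using q_deriv by (simp add: scaleR_conv_of_real)
        show "Ck_within k {0..} (\<lambda>s. (1/4) *\<^sub>R (- \<i> * q s + v s))"
          by (intro Ck_within_linear[OF bounded_linear_scaleR_right] Ck_within_add
              Ck_within_linear[OF bounded_linear_mult_right] Suc step)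
      qed
    qed
    then show ?thesis using step by blast
  qed
  then have "Ck_within (Suc 0) {0..} v" by blast
  then obtain v' where v': "\<And>s. s \<in> {0..} \<Longrightarrow> (v has_vector_derivative v' s) (at s within {0..})"
    using Ck_within_vector_derivative_E by blast
  \<comment> \<open>For positive \<open>s\<close> this is \<open>v_deriv\<close>, by uniqueness of
    the derivative. At 0 the left side vanishes and the value of the average there makes the right
    side vanish too.\<close>
  have sv': "s * v' s = (\<i> * b0 - h0 (q s)) * q s - (d / 2) * v s" if s: "s \<ge> 0" for s
  proof (cases "s = 0")
    case True
    have "v 0 = (2 / d) *\<^sub>R N (q 0)" using radial_avg_at_0[of m "\<lambda>x. N (q x)"] m by (simp add: v_def d_def)
    then show ?thesis using True d1 by (simp add: N_def scaleR_conv_of_real)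
  next
    case False
    then have "at s within {0..} = at s" using s at_within_interior[of s "{0..}"] interior_real_atLeast[of 0] by simp
    then have "v' s = ((\<i> * b0 - h0 (q s)) * q s - (d / 2) * v s) / s"
      using v'[of s] v_deriv[of s] False s vector_derivative_unique_at by fastforce
    then show ?thesis using False by simp
  qed
  define q1 where "q1 s = (- \<i> * q s + v s) / 4" for s
  define q2 where "q2 s = (- \<i> * q1 s + v' s) / 4" for s
  have q1': "(q has_vector_derivative q1 s) (at s within {0..})" if "s \<ge> 0" for s
    using q_deriv[OF that] by (simp add: q1_def)
  show thesis
  proof (rule that[of q "(1 + S) powr b * \<delta>\<^sup>2" q1 q2])
    show "\<And>k. Ck_within k {0..} q" using smooth by blast
    show "\<And>s. s \<ge> 0 \<Longrightarrow> q s \<noteq> 0" by (rule nz)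
    show "(1 + S) powr b * \<delta>\<^sup>2 > 0" using S0 \<delta> by simp
    show "(cmod (q s))\<^sup>2 \<le> (1 + S) powr b * \<delta>\<^sup>2 * (1 + s) powr (- b)" if "s \<ge> 0" for s
      using decay[OF that] that S0 by (simp add: powr_divide powr_minus field_simps)
    show "\<And>s. s \<ge> 0 \<Longrightarrow> (q has_vector_derivative q1 s) (at s within {0..})" by (rule q1')
  next
    fix s :: real assume s: "s \<ge> 0"
    have "((\<lambda>s. (- \<i> * q s + v s) / 4) has_vector_derivative (- \<i> * q1 s + v' s) / 4) (at s within {0..})"
      using s by (intro has_vector_derivative_divide has_vector_derivative_add has_vector_derivative_mult_right q1' v') auto
    then show "(q1 has_vector_derivative q2 s) (at s within {0..})" by (simp add: q1_def[abs_def] q2_def)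
    \<comment> \<open>Eliminating \<open>v\<close> from the first order system yields the second
      order equation; the coefficient \<open>d / 2 - b0\<close> left at \<open>\<i> * q s\<close> is
      \<open>1 / (2 * \<sigma>)\<close>.\<close>
    have vq: "v s = 4 * q1 s + \<i> * q s" by (simp add: q1_def field_simps)
    have "d / 2 - b0 = 1 / (2 * \<sigma>)" using \<kappa> unfolding \<kappa>_def by linarith
    then have \<kappa>': "\<i> / of_real (2 * \<sigma>) = \<i> * complex_of_real (d / 2 - b0)" by (simp only:) simp
    have "4 * of_real s * q2 s = - \<i> * of_real s * q1 s + of_real s * v' s" by (simp add: q2_def field_simps)
    also have "\<dots> = - \<i> * of_real s * q1 s + ((\<i> * b0 - h0 (q s)) * q s - (d / 2) * (4 * q1 s + \<i> * q s))"
      unfolding sv'[OF s] vq ..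
    finally show "4 * of_real s * q2 s + 2 * of_nat n * q1 s + \<i> * of_real s * q1 s + \<i> / of_real (2 * \<sigma>) * q s
        + complex_of_real (cmod (q s) powr (2 * \<sigma>)) * q s = 0"
      unfolding \<kappa>' h0q[OF s] by (simp add: d_def algebra_simps)
  qed
qed

section \<open>Self-similar solutions\<close>

definition self_similar :: "real \<Rightarrow> (real \<Rightarrow> complex) \<Rightarrow> real \<Rightarrow> real^'n::finite \<Rightarrow> complex" where
  "self_similar \<alpha> q t x = ((1 - t) powr (- \<alpha>)) *\<^sub>R q ((x \<bullet> x) / (1 - t))"

lemma smooth_on_self_similar:
  assumes q: "\<And>k. Ck_within k {0..} q"
  shows "smooth_on ({0<..<1} \<times> UNIV) (\<lambda>(t, x :: real^'n::finite). self_similar \<alpha> q t x)"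
proof -
  let ?S = "{0<..<1::real} \<times> (UNIV :: (real^'n) set)"
  have "Ck_within k ?S (\<lambda>z. self_similar \<alpha> q (fst z) (snd z))" for k
  proof -
    have T: "Ck_within k ?S (\<lambda>z. 1 + (- 1) *\<^sub>R fst z)"
      by (intro Ck_within_add Ck_within_const Ck_within_linear[OF bounded_linear_scaleR_right]
          Ck_within_linear[OF bounded_linear_fst] Ck_within_id)
    have powr: "Ck_within k ?S (\<lambda>z. (1 + (- 1) *\<^sub>R fst z) powr c)" for c
      by (rule Ck_within_compose[OF Ck_within_powr T]) auto
    have X: "Ck_within k ?S (\<lambda>z. snd z \<bullet> snd z)"
      by (intro Ck_within_bilinear[OF bounded_bilinear_inner] Ck_within_linear[OF bounded_linear_snd] Ck_within_id)
    \<comment> \<open>Division is written as a power with exponent -1, so that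
      \<open>Ck_within_powr\<close> covers it.\<close>
    have "Ck_within k ?S (\<lambda>z. (snd z \<bullet> snd z) * (1 + (- 1) *\<^sub>R fst z) powr (- 1))"
      by (rule Ck_within_bilinear[OF bounded_bilinear_mult X powr])
    then have "Ck_within k ?S (\<lambda>z. q ((snd z \<bullet> snd z) * (1 + (- 1) *\<^sub>R fst z) powr (- 1)))"
      by (rule Ck_within_compose[OF q]) auto
    from Ck_within_bilinear[OF bounded_bilinear_scaleR powr[of "- \<alpha>"] this]
    show ?thesis
      by (rule Ck_within_cong) (auto simp: self_similar_def powr_minus divide_inverse)
  qed
  moreover have "open ?S" by (intro open_Times) auto
  ultimately show ?thesis by (simp add: smooth_on_def Ck_within_open case_prod_beta')
qed

text \<open>Smoothness is stated for positive times only; this supplies continuity up to the initial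
  time.\<close>

lemma continuous_on_self_similar:
  assumes "continuous_on {0..} q"
  shows "continuous_on ({..<1} \<times> UNIV) (\<lambda>(t, x :: real^'n::finite). self_similar \<alpha> q t x)"
proof -
  let ?S = "{..<1::real} \<times> (UNIV :: (real^'n) set)"
  have "continuous_on ?S (\<lambda>z. (snd z \<bullet> snd z) / (1 - fst z))"
    by (rule continuous_on_divide) (auto intro!: continuous_intros)
  then have "continuous_on ?S (\<lambda>z. q ((snd z \<bullet> snd z) / (1 - fst z)))"
    by (rule continuous_on_compose2[OF assms]) auto
  moreover have "continuous_on ?S (\<lambda>z. (1 - fst z) powr (- \<alpha>))"
    by (rule continuous_on_powr) (auto intro!: continuous_intros)
  ultimately have "continuous_on ?S (\<lambda>z. ((1 - fst z) powr (- \<alpha>)) *\<^sub>R q ((snd z \<bullet> snd z) / (1 - fst z)))"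
    by (intro continuous_on_scaleR)
  then show ?thesis by (simp add: self_similar_def case_prod_beta')
qed

text \<open>A one-sided derivative of \<open>q\<close> at 0 suffices for a two-sided derivative of
  the composition, because \<open>f\<close> does not leave the half line near \<open>t\<close>. This
  covers the spatial origin, where the argument of the profile is 0.\<close>

lemma has_vector_derivative_comp_nonneg:
  fixes q q1 :: "real \<Rightarrow> complex"
  assumes "\<And>s. s \<ge> 0 \<Longrightarrow> (q has_vector_derivative q1 s) (at s within {0..})"
    and "open U" "t \<in> U" "\<And>u. u \<in> U \<Longrightarrow> f u \<ge> 0" and "(f has_real_derivative f') (at t)"
  shows "((\<lambda>u. q (f u)) has_vector_derivative f' *\<^sub>R q1 (f t)) (at t)"
proof -
  have "((q \<circ> f) has_vector_derivative f' *\<^sub>R q1 (f t)) (at t within U)"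
  proof (rule vector_diff_chain_within)
    show "(f has_vector_derivative f') (at t within U)"
      using assms(5) by (simp add: has_real_derivative_iff_has_vector_derivative has_vector_derivative_at_within)
    show "(q has_vector_derivative q1 (f t)) (at (f t) within f ` U)"
      using assms by (intro has_vector_derivative_within_subset[OF assms(1)]) auto
  qed
  then show ?thesis by (simp only: at_within_open[OF assms(3,2)] o_def)
qed

lemma partial_t_self_similar:
  fixes x :: "real^'n::finite"
  assumes q: "\<And>s. s \<ge> 0 \<Longrightarrow> (q has_vector_derivative q1 s) (at s within {0..})" and t: "t < 1"
  defines "s \<equiv> (x \<bullet> x) / (1 - t)"
  shows "partial_t (self_similar \<alpha> q) t x = ((1 - t) powr (- \<alpha>) / (1 - t)) *\<^sub>R (\<alpha> *\<^sub>R q s + s *\<^sub>R q1 s)"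
proof -
  have "((\<lambda>t. (x \<bullet> x) / (1 - t)) has_real_derivative s / (1 - t)) (at t)"
    using t by (auto intro!: derivative_eq_intros simp: s_def power2_eq_square)
  then have 1: "((\<lambda>t. q ((x \<bullet> x) / (1 - t))) has_vector_derivative (s / (1 - t)) *\<^sub>R q1 s) (at t)"
    unfolding s_def by (intro has_vector_derivative_comp_nonneg[OF q, of "{..<1}"]) (use t in auto)
  have 2: "((\<lambda>t. (1 - t) powr (- \<alpha>)) has_real_derivative \<alpha> * ((1 - t) powr (- \<alpha>) / (1 - t))) (at t)"
    using t by (auto intro!: derivative_eq_intros simp: powr_diff)
  from has_vector_derivative_scaleR[OF 2 1]
  have "((\<lambda>t. self_similar \<alpha> q t x) has_vector_derivative
     ((1 - t) powr (- \<alpha>) / (1 - t)) *\<^sub>R (\<alpha> *\<^sub>R q s + s *\<^sub>R q1 s)) (at t)"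
    by (simp add: self_similar_def s_def scaleR_add_right mult_ac add.commute)
  then show ?thesis unfolding partial_t_def by (rule vector_derivative_at)
qed

lemma laplacian_self_similar:
  fixes x :: "real^'n::finite"
  assumes q: "\<And>s. s \<ge> 0 \<Longrightarrow> (q has_vector_derivative q1 s) (at s within {0..})"
    and q1: "\<And>s. s \<ge> 0 \<Longrightarrow> (q1 has_vector_derivative q2 s) (at s within {0..})" and t: "t < 1"
  defines "s \<equiv> (x \<bullet> x) / (1 - t)"
  shows "laplacian (self_similar \<alpha> q t) x =
    ((1 - t) powr (- \<alpha>) / (1 - t)) *\<^sub>R ((2 * real CARD('n)) *\<^sub>R q1 s + (4 * s) *\<^sub>R q2 s)"
proof -
  define T K where "T = 1 - t" and "K = T powr (- \<alpha>)"
  have T: "T > 0" using t by (simp add: T_def)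
  \<comment> \<open>Stated for a general profile because it serves \<open>q\<close> and, for the
    second derivative, \<open>q1\<close>.\<close>
  have dq: "((\<lambda>h. f (((y + h *\<^sub>R axis j 1) \<bullet> (y + h *\<^sub>R axis j 1)) / T)) has_vector_derivative
      (2 * y $ j / T) *\<^sub>R f' ((y \<bullet> y) / T)) (at 0)"
    if f: "\<And>s. s \<ge> 0 \<Longrightarrow> (f has_vector_derivative f' s) (at s within {0..})"
    for f f' :: "real \<Rightarrow> complex" and y :: "real^'n" and j
  proof -
    have eq: "(y + h *\<^sub>R axis j 1) \<bullet> (y + h *\<^sub>R axis j 1) = y \<bullet> y + 2 * h * y $ j + h\<^sup>2" for h :: real
      by (simp add: inner_add_left inner_add_right inner_axis inner_axis' power2_eq_square distrib_left)
    have "((\<lambda>h. ((y + h *\<^sub>R axis j 1) \<bullet> (y + h *\<^sub>R axis j 1)) / T) has_real_derivative 2 * y $ j / T) (at 0)"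
      unfolding eq using T by (auto intro!: derivative_eq_intros)
    from has_vector_derivative_comp_nonneg[OF f _ _ _ this, of UNIV] T
    show ?thesis by simp
  qed
  have p1: "partial_x j (self_similar \<alpha> q t) y = (2 * K * y $ j / T) *\<^sub>R q1 ((y \<bullet> y) / T)" for y :: "real^'n" and j
  proof -
    have "((\<lambda>h. K *\<^sub>R q (((y + h *\<^sub>R axis j 1) \<bullet> (y + h *\<^sub>R axis j 1)) / T)) has_vector_derivative
        K *\<^sub>R (2 * y $ j / T) *\<^sub>R q1 ((y \<bullet> y) / T)) (at 0)"
      by (rule bounded_linear.has_vector_derivative[OF bounded_linear_scaleR_right dq[OF q]])
    then show ?thesis
      unfolding partial_x_def self_similar_def T_def[symmetric] K_def[symmetric]
      by (simp add: vector_derivative_at mult_ac)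
  qed
  have p2: "partial_x j (partial_x j (self_similar \<alpha> q t)) x =
      (2 * K / T) *\<^sub>R q1 s + (4 * K * (x $ j)\<^sup>2 / T\<^sup>2) *\<^sub>R q2 s" for j
  proof -
    have "((\<lambda>h. 2 * K * (x + h *\<^sub>R axis j 1) $ j / T) has_real_derivative 2 * K / T) (at 0)"
      using T by (auto intro!: derivative_eq_intros simp: axis_def)
    from has_vector_derivative_scaleR[OF this dq[OF q1]]
    have "((\<lambda>h. (2 * K * (x + h *\<^sub>R axis j 1) $ j / T) *\<^sub>R
        q1 (((x + h *\<^sub>R axis j 1) \<bullet> (x + h *\<^sub>R axis j 1)) / T)) has_vector_derivative
        (2 * K / T) *\<^sub>R q1 s + (4 * K * (x $ j)\<^sup>2 / T\<^sup>2) *\<^sub>R q2 s) (at 0)"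
      by (simp add: s_def T_def[symmetric] power2_eq_square mult_ac add.commute)
    then show ?thesis
      unfolding p1[abs_def] partial_x_def[of j "\<lambda>y. (2 * K * y $ j / T) *\<^sub>R q1 ((y \<bullet> y) / T)"]
      by (rule vector_derivative_at)
  qed
  have "x \<bullet> x = (\<Sum>j\<in>UNIV. (x $ j)\<^sup>2)" by (simp add: inner_vec_def power2_eq_square)
  then have "(\<Sum>j\<in>UNIV. (4 * K * (x $ j)\<^sup>2 / T\<^sup>2) *\<^sub>R q2 s) = (4 * K * (x \<bullet> x) / T\<^sup>2) *\<^sub>R q2 s"
    by (simp add: scaleR_sum_left[symmetric] sum_distrib_left sum_divide_distrib)
  moreover have "4 * K * (x \<bullet> x) / T\<^sup>2 = (K / T) * (4 * s)" by (simp add: s_def T_def power2_eq_square)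
  ultimately have "laplacian (self_similar \<alpha> q t) x = (real CARD('n) * (2 * K / T)) *\<^sub>R q1 s + ((K / T) * (4 * s)) *\<^sub>R q2 s"
    unfolding laplacian_def p2 sum.distrib by (simp add: scaleR_conv_of_real)
  then show ?thesis by (simp add: scaleR_add_right K_def T_def mult_ac)
qed

text \<open>The exponent \<open>1 / (2 * \<sigma>)\<close> makes
  \<open>K powr (2 * \<sigma>)\<close> equal to \<open>1 / T\<close>, so every term carries the
  common factor \<open>K / T\<close> and what remains is the profile equation at
  \<open>s\<close>.\<close>

lemma self_similar_solves_NLS:
  fixes x :: "real^'n::finite"
  assumes q: "\<And>s. s \<ge> 0 \<Longrightarrow> (q has_vector_derivative q1 s) (at s within {0..})"
    and q1: "\<And>s. s \<ge> 0 \<Longrightarrow> (q1 has_vector_derivative q2 s) (at s within {0..})"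
    and ode: "\<And>s. s \<ge> 0 \<Longrightarrow> 4 * of_real s * q2 s + 2 * of_nat CARD('n) * q1 s + \<i> * of_real s * q1 s
        + \<i> / of_real (2 * \<sigma>) * q s + complex_of_real (cmod (q s) powr (2 * \<sigma>)) * q s = 0"
    and t: "t < 1" and \<sigma>: "\<sigma> > 0"
  defines "\<psi> \<equiv> self_similar (1 / (2 * \<sigma>)) q"
  shows "\<i> * partial_t \<psi> t x + laplacian (\<psi> t) x + complex_of_real (cmod (\<psi> t x) powr (2 * \<sigma>)) * \<psi> t x = 0"
proof -
  define T s K where "T = 1 - t" and "s = (x \<bullet> x) / T" and "K = T powr (- (1 / (2 * \<sigma>)))"
  have T: "T > 0" using t by (simp add: T_def)
  have s: "s \<ge> 0" using T by (simp add: s_def)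
  have K: "K \<ge> 0" by (simp add: K_def)
  have "K powr (2 * \<sigma>) = T powr (- 1)" using \<sigma> by (simp add: K_def powr_powr)
  then have K\<sigma>: "K powr (2 * \<sigma>) = inverse T" using T by (simp add: powr_minus)
  have \<psi>: "\<psi> t x = K *\<^sub>R q s" by (simp add: \<psi>_def self_similar_def T_def K_def s_def)
  have "complex_of_real (cmod (\<psi> t x) powr (2 * \<sigma>)) * \<psi> t x
      = of_real (K / T) * (of_real (cmod (q s) powr (2 * \<sigma>)) * q s)"
  proof -
    have "cmod (\<psi> t x) powr (2 * \<sigma>) = inverse T * cmod (q s) powr (2 * \<sigma>)"
      using K unfolding \<psi> norm_scaleR by (simp add: powr_mult K\<sigma>)
    then show ?thesis unfolding \<psi> by (simp add: scaleR_conv_of_real divide_inverse)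
  qed
  moreover have "partial_t \<psi> t x = of_real (K / T) * (of_real (1 / (2 * \<sigma>)) * q s + of_real s * q1 s)"
    using partial_t_self_similar[of q q1 t "1 / (2 * \<sigma>)" x, OF _ t] q
    by (simp add: \<psi>_def T_def K_def s_def scaleR_conv_of_real)
  moreover have "laplacian (\<psi> t) x = of_real (K / T) * (2 * of_nat CARD('n) * q1 s + 4 * of_real s * q2 s)"
    using laplacian_self_similar[of q q1 q2 t "1 / (2 * \<sigma>)" x, OF _ _ t] q q1
    by (simp add: \<psi>_def T_def K_def s_def scaleR_conv_of_real)
  moreover have "\<i> / of_real (2 * \<sigma>) = \<i> * of_real (1 / (2 * \<sigma>))" by simp
  ultimately have "\<i> * partial_t \<psi> t x + laplacian (\<psi> t) x + complex_of_real (cmod (\<psi> t x) powr (2 * \<sigma>)) * \<psi> t x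
    = of_real (K / T) * (4 * of_real s * q2 s + 2 * of_nat CARD('n) * q1 s + \<i> * of_real s * q1 s
        + \<i> / of_real (2 * \<sigma>) * q s + complex_of_real (cmod (q s) powr (2 * \<sigma>)) * q s)"
    by (simp only: algebra_simps)
  then show ?thesis by (simp only: ode[OF s] mult_zero_right)
qed

section \<open>Norms of self-similar solutions\<close>

lemma nn_integral_lborel_scaleR:
  fixes f :: "'a::euclidean_space \<Rightarrow> ennreal"
  assumes [measurable]: "f \<in> borel_measurable borel" and c: "c > 0"
  shows "(\<integral>\<^sup>+x. f x \<partial>lborel) = ennreal (c ^ DIM('a)) * (\<integral>\<^sup>+x. f (c *\<^sub>R x) \<partial>lborel)"
  using c by (subst lborel_affine[of c "0 :: 'a"])
    (simp_all add: nn_integral_density nn_integral_distr nn_integral_cmult)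

text \<open>Dyadic comparison: the integrand is dominated by a sum of multiples of indicators of
  balls of radius \<open>2 ^ k\<close>. Their integrals form a geometric series with ratio
  \<open>a\<close>, which is below 1 because \<open>\<gamma>\<close> exceeds the dimension.\<close>

lemma nn_integral_radial_powr_finite:
  assumes \<gamma>: "\<gamma> > real DIM('a::euclidean_space)"
  shows "(\<integral>\<^sup>+(x::'a). ennreal ((1 + x \<bullet> x) powr (- \<gamma> / 2)) \<partial>lborel) < \<infinity>"
proof -
  define V where "V = unit_ball_vol (DIM('a))"
  define a where "a = 2 powr (real DIM('a) - \<gamma>)"
  have \<gamma>0: "\<gamma> > 0" using \<gamma> by (rule le_less_trans[rotated]) simp
  have a: "0 < a" "a < 1" using \<gamma> by (auto simp: a_def powr_less_one)
  \<comment> \<open>For the least \<open>k >= 1\<close> whose ball contains \<open>x\<close>, the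
    norm is only known to exceed \<open>2 ^ (k - 1)\<close>; the factor
    \<open>2 powr \<gamma>\<close> pays for this shift.\<close>
  define f where "f k x = ennreal (2 powr \<gamma> * (2 ^ k) powr (- \<gamma>)) * indicator (cball (0::'a) (2 ^ k)) x" for k :: nat and x
  have fm: "f k \<in> borel_measurable lborel" for k
    unfolding f_def[abs_def]
    by (intro borel_measurable_times_ennreal borel_measurable_const borel_measurable_indicator) simp
  have le: "ennreal ((1 + x \<bullet> x) powr (- \<gamma> / 2)) \<le> (\<Sum>k. f k x)" for x :: 'a
  proof -
    obtain k0 :: nat where "norm x < 2 ^ k0" using real_arch_pow[of 2 "norm x"] by auto
    then have ex: "\<exists>k. norm x \<le> 2 ^ k" by (auto intro: less_imp_le)
    define k where "k = (LEAST k. norm x \<le> 2 ^ k)"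
    have k: "norm x \<le> 2 ^ k" unfolding k_def by (rule LeastI_ex[OF ex])
    have "(1 + x \<bullet> x) powr (- \<gamma> / 2) \<le> 2 powr \<gamma> * (2 ^ k) powr (- \<gamma>)"
    proof (cases k)
      case 0
      have "(1 + x \<bullet> x) powr (- \<gamma> / 2) \<le> (1 + x \<bullet> x) powr 0"
        using \<gamma>0 by (intro powr_mono) auto
      also have "\<dots> = 1" using add_pos_nonneg[of 1 "x \<bullet> x"] by simp
      also have "\<dots> \<le> 2 powr \<gamma>" using \<gamma>0 by (intro ge_one_powr_ge_zero) auto
      finally show ?thesis using 0 by simp
    next
      case (Suc j)
      then have "\<not> norm x \<le> 2 ^ j" using not_less_Least[of j "\<lambda>k. norm x \<le> 2 ^ k"] by (simp add: k_def)
      then have j: "2 ^ j < norm x" by simp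
      then have x: "norm x > 0" by (rule le_less_trans[rotated]) simp
      have "(1 + x \<bullet> x) powr (- \<gamma> / 2) \<le> ((norm x)\<^sup>2) powr (- \<gamma> / 2)"
        using x \<gamma>0 by (intro powr_mono2') (auto simp: power2_norm_eq_inner)
      also have "\<dots> = norm x powr (- \<gamma>)" using x by (simp add: powr_powr flip: powr_numeral)
      also have "\<dots> \<le> (2 ^ j) powr (- \<gamma>)" using j \<gamma>0 by (intro powr_mono2') auto
      also have "\<dots> = 2 powr \<gamma> * (2 ^ k) powr (- \<gamma>)"
        unfolding Suc power_Suc by (simp add: powr_mult powr_minus)
      finally show ?thesis .
    qed
    then have "ennreal ((1 + x \<bullet> x) powr (- \<gamma> / 2)) \<le> f k x"
      using k by (simp add: f_def ennreal_leI)
    also have "\<dots> \<le> (\<Sum>k. f k x)"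
      using sum_le_suminf[of "\<lambda>k. f k x" "{k}"] by simp
    finally show ?thesis .
  qed
  have I: "(\<integral>\<^sup>+x. f k x \<partial>lborel) = ennreal (2 powr \<gamma> * V * a ^ k)" for k
  proof -
    have "(\<integral>\<^sup>+x. f k x \<partial>lborel) = ennreal (2 powr \<gamma> * (2 ^ k) powr (- \<gamma>)) * ennreal (V * (2 ^ k) ^ DIM('a))"
      unfolding f_def V_def by (subst nn_integral_cmult_indicator) (simp_all add: emeasure_cball)
    also have "\<dots> = ennreal (2 powr \<gamma> * V * ((2 ^ k) powr (- \<gamma>) * (2 ^ k) ^ DIM('a)))"
      by (subst ennreal_mult[symmetric]) (auto simp: V_def mult_ac)
    also have "((2::real) ^ k) powr (- \<gamma>) * (2 ^ k) ^ DIM('a) = a ^ k"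
    proof -
      have "((2::real) ^ k) powr (- \<gamma>) * (2 ^ k) ^ DIM('a) = ((2 ^ k) powr (- \<gamma>)) * (2 ^ k) powr (real DIM('a))"
        by (subst powr_realpow) auto
      also have "\<dots> = (2 ^ k) powr (real DIM('a) - \<gamma>)" by (simp add: powr_add[symmetric])
      also have "\<dots> = (2 powr real k) powr (real DIM('a) - \<gamma>)" by (simp add: powr_realpow)
      also have "\<dots> = a powr real k" by (simp add: a_def powr_powr mult.commute)
      also have "\<dots> = a ^ k" using a by (simp add: powr_realpow)
      finally show ?thesis .
    qed
    finally show ?thesis .
  qed
  have "summable (\<lambda>k. 2 powr \<gamma> * V * a ^ k)"
    using a by (intro summable_mult summable_geometric) simp
  then have fin: "(\<Sum>k. ennreal (2 powr \<gamma> * V * a ^ k)) < \<infinity>"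
    using a by (subst suminf_ennreal2) (auto simp: V_def)
  have "(\<integral>\<^sup>+(x::'a). ennreal ((1 + x \<bullet> x) powr (- \<gamma> / 2)) \<partial>lborel) \<le> (\<integral>\<^sup>+x. (\<Sum>k. f k x) \<partial>lborel)"
    by (intro nn_integral_mono le)
  also have "\<dots> = (\<Sum>k. (\<integral>\<^sup>+x. f k x \<partial>lborel))"
    by (rule nn_integral_suminf[OF fm])
  also have "\<dots> < \<infinity>" unfolding I by (rule fin)
  finally show ?thesis .
qed

text \<open>Rescaling space by \<open>sqrt (1 - t)\<close> moves the time dependence into a power:
  the amplitude gives \<open>- \<alpha> * P\<close>, the volume half the dimension, and the root
  divides by \<open>P\<close>. The condition on \<open>b * P\<close> makes the integral of the fixed
  profile finite.\<close>

lemma lp_norm_self_similar: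
  fixes q :: "real \<Rightarrow> complex" and P :: real
  assumes q: "continuous_on {0..} q" "\<And>s. s \<ge> 0 \<Longrightarrow> q s \<noteq> 0"
    and C: "\<And>s. s \<ge> 0 \<Longrightarrow> (cmod (q s))\<^sup>2 \<le> C * (1 + s) powr (- b)"
    and P: "P > 0" "b * P > real CARD('n::finite)"
  obtains c where "c > 0" "\<And>t. t < 1 \<Longrightarrow>
    lp_norm (ereal P) (self_similar \<alpha> q t :: real^'n \<Rightarrow> complex) = ereal (c * (1 - t) powr (real CARD('n) / (2 * P) - \<alpha>))"
proof -
  define F where "F y = cmod (q (y \<bullet> y)) powr P" for y :: "real^'n"
  define I where "I = (\<integral>\<^sup>+y. ennreal (F y) \<partial>lborel)"
  have "continuous_on UNIV (\<lambda>y :: real^'n. q (y \<bullet> y))"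
    by (rule continuous_on_compose2[OF q(1)]) (auto intro!: continuous_intros)
  then have [measurable]: "(\<lambda>y :: real^'n. q (y \<bullet> y)) \<in> borel_measurable borel"
    by (rule borel_measurable_continuous_onI)
  have Fm [measurable]: "F \<in> borel_measurable borel" unfolding F_def[abs_def] by measurable
  have "F y \<le> C powr (P / 2) * (1 + y \<bullet> y) powr (- (b * P) / 2)" for y
  proof -
    have pos: "1 + y \<bullet> y > 0" by (simp add: add_pos_nonneg)
    have nz: "cmod (q (y \<bullet> y)) > 0" using q(2) by simp
    have Cpos: "C * (1 + y \<bullet> y) powr (- b) > 0"
      using C[of "y \<bullet> y"] nz by (smt (verit) inner_ge_zero zero_less_power)
    then have C0: "C > 0" using pos by (simp add: zero_less_mult_iff)
    have "F y = ((cmod (q (y \<bullet> y)))\<^sup>2) powr (P / 2)"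
      using nz by (simp add: F_def powr_powr flip: powr_numeral)
    also have "\<dots> \<le> (C * (1 + y \<bullet> y) powr (- b)) powr (P / 2)"
      using C P by (intro powr_mono2) auto
    also have "\<dots> = C powr (P / 2) * (1 + y \<bullet> y) powr (- (b * P) / 2)"
      using C0 pos by (simp add: powr_mult powr_powr)
    finally show ?thesis .
  qed
  then have "I \<le> (\<integral>\<^sup>+(y::real^'n). ennreal (C powr (P / 2)) * ennreal ((1 + y \<bullet> y) powr (- (b * P) / 2)) \<partial>lborel)"
    unfolding I_def by (intro nn_integral_mono) (simp add: ennreal_mult[symmetric] ennreal_leI)
  also have "\<dots> = ennreal (C powr (P / 2)) * (\<integral>\<^sup>+(y::real^'n). ennreal ((1 + y \<bullet> y) powr (- (b * P) / 2)) \<partial>lborel)"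
    by (intro nn_integral_cmult) measurable
  also have "\<dots> < \<infinity>"
    using nn_integral_radial_powr_finite[where 'a="real^'n", of "b * P"] P by (simp add: ennreal_mult_less_top)
  finally have Ifin: "I < \<infinity>" .
  \<comment> \<open>Blow-up needs a positive constant \<open>c\<close>; the absence of zeros of
    \<open>q\<close> provides it.\<close>
  have "I \<noteq> 0"
  proof
    assume "I = 0"
    then have "AE y in lborel. ennreal (F y) = 0"
      unfolding I_def by (subst (asm) nn_integral_0_iff_AE) auto
    moreover have "ennreal (F y) \<noteq> 0" for y using q(2)[of "y \<bullet> y"] by (simp add: F_def)
    ultimately have "AE y in (lborel :: (real^'n) measure). False" by simp
    then show False by (simp add: eventually_False ae_filter_eq_bot_iff)
  qed
  define i where "i = enn2real I"
  have i: "I = ennreal i" "i > 0"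
    using Ifin \<open>I \<noteq> 0\<close> by (auto simp: i_def enn2real_positive_iff zero_less_iff_neq_zero)
  show thesis
  proof
    show "i powr (1 / P) > 0" using i by simp
    fix t :: real assume t: "t < 1"
    define T where "T = 1 - t"
    have T: "T > 0" using t by (simp add: T_def)
    have "cmod (self_similar \<alpha> q t x) powr P = T powr (- \<alpha> * P) * F (inverse (sqrt T) *\<^sub>R x)" for x :: "real^'n"
    proof -
      have "(inverse (sqrt T) *\<^sub>R x) \<bullet> (inverse (sqrt T) *\<^sub>R x) = (x \<bullet> x) / T"
        using T by (simp add: field_simps)
      then show ?thesis
        using T by (simp add: self_similar_def F_def T_def[symmetric] powr_mult powr_powr)
    qed
    then have "(\<integral>\<^sup>+(x::real^'n). ennreal (cmod (self_similar \<alpha> q t x) powr P) \<partial>lborel)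
      = (\<integral>\<^sup>+(x::real^'n). ennreal (T powr (- \<alpha> * P)) * ennreal (F (inverse (sqrt T) *\<^sub>R x)) \<partial>lborel)"
      by (simp add: ennreal_mult F_def)
    also have "\<dots> = ennreal (T powr (- \<alpha> * P)) * (\<integral>\<^sup>+(x::real^'n). ennreal (F (inverse (sqrt T) *\<^sub>R x)) \<partial>lborel)"
      by (intro nn_integral_cmult) measurable
    also have "(\<integral>\<^sup>+(x::real^'n). ennreal (F (inverse (sqrt T) *\<^sub>R x)) \<partial>lborel) = ennreal (sqrt T ^ CARD('n)) * I"
      using nn_integral_lborel_scaleR[of "\<lambda>x::real^'n. ennreal (F (inverse (sqrt T) *\<^sub>R x))" "sqrt T"] T
      by (simp add: I_def)
    also have "sqrt T ^ CARD('n) = T powr (real CARD('n) / 2)"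
      using T by (simp add: powr_half_sqrt[symmetric] powr_powr flip: powr_realpow)
    also have "ennreal (T powr (- \<alpha> * P)) * (ennreal (T powr (real CARD('n) / 2)) * I) =
        ennreal (T powr (real CARD('n) / 2 - \<alpha> * P) * i)"
      using i T by (simp add: ennreal_mult[symmetric] powr_add[symmetric] mult.assoc[symmetric])
    finally have J: "(\<integral>\<^sup>+(x::real^'n). ennreal (cmod (self_similar \<alpha> q t x) powr P) \<partial>lborel) =
        ennreal (T powr (real CARD('n) / 2 - \<alpha> * P) * i)" .
    have "(T powr (real CARD('n) / 2 - \<alpha> * P) * i) powr (1 / P) =
        T powr ((real CARD('n) / 2 - \<alpha> * P) * (1 / P)) * i powr (1 / P)"
      using i by (simp add: powr_mult powr_powr)
    also have "(real CARD('n) / 2 - \<alpha> * P) * (1 / P) = real CARD('n) / (2 * P) - \<alpha>"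
      using P by (simp add: field_simps)
    finally show "lp_norm (ereal P) (self_similar \<alpha> q t :: real^'n \<Rightarrow> complex) =
        ereal (i powr (1 / P) * (1 - t) powr (real CARD('n) / (2 * P) - \<alpha>))"
      using i by (simp add: lp_norm_def J T_def[symmetric] mult.commute)
  qed
qed

text \<open>If one value exceeded the essential supremum, continuity would spread this to a nonempty
  open set, which is not a null set.\<close>

lemma esssup_lborel_ge:
  fixes g :: "'a::euclidean_space \<Rightarrow> real"
  assumes "continuous_on UNIV g"
  shows "ereal (g x) \<le> esssup lborel (\<lambda>x. ereal (g x))"
proof (rule ccontr)
  define e where "e = esssup lborel (\<lambda>x. ereal (g x))"
  define U where "U = {x. e < ereal (g x)}"
  assume "\<not> ereal (g x) \<le> esssup lborel (\<lambda>x. ereal (g x))"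
  then have "x \<in> U" by (simp add: U_def e_def)
  have "open U"
    unfolding U_def using assms by (intro open_Collect_less continuous_intros continuous_on_ereal)
  then have "\<not> negligible U" using \<open>x \<in> U\<close> open_not_negligible by blast
  moreover have "emeasure lborel U = 0"
    using esssup_zero_measure[of lborel "\<lambda>x. ereal (g x)"] by (simp add: U_def e_def)
  then have "U \<in> null_sets lborel" using \<open>open U\<close> by (auto simp: null_sets_def)
  then have "negligible U" by (simp add: negligible_iff_null_sets null_sets_completionI)
  ultimately show False by blast
qed

lemma powr_blowup:
  fixes c e :: real
  assumes "c > 0" "e < 0"
  shows "((\<lambda>t. ereal (c * (1 - t) powr e)) \<longlongrightarrow> \<infinity>) (at_left 1)"
  unfolding tendsto_PInfty_eq_at_top
proof (rule filterlim_tendsto_pos_mult_at_top[OF tendsto_const assms(1)])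
  have "((\<lambda>t. (1 - t) powr (- e)) \<longlongrightarrow> 0 powr (- e)) (at_left (1::real))"
    using assms by (intro tendsto_intros) (auto intro!: tendsto_eq_intros eventually_at_leftI[of 0])
  then have "filterlim (\<lambda>t. inverse ((1 - t) powr (- e))) at_top (at_left (1::real))"
    by (intro filterlim_inverse_at_top) (auto intro!: eventually_at_leftI[of 0])
  then show "filterlim (\<lambda>t. (1 - t) powr e) at_top (at_left (1::real))"
    by (simp add: powr_minus)
qed

section \<open>Choice of the decay rate and blow-up of the norms\<close>

theorem theorem2:
  fixes \<sigma> :: real and p :: ereal
  assumes "\<sigma> > 0" and "1 < \<sigma> * real CARD('n::finite)" and "\<sigma> * real CARD('n) < 2"
    and "ereal (\<sigma> * real CARD('n) / (\<sigma> * real CARD('n) - 1)) < p"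
  shows "\<exists>(\<psi> :: real \<Rightarrow> real^'n \<Rightarrow> complex) Tc. Tc > 0 \<and>
     smooth_on ({0<..<Tc} \<times> UNIV) (\<lambda>(t, x). \<psi> t x) \<and>
     continuous_on ({0..<Tc} \<times> UNIV) (\<lambda>(t, x). \<psi> t x) \<and>
     (\<forall>t\<in>{0<..<Tc}. \<forall>x. \<i> * partial_t \<psi> t x + laplacian (\<psi> t) x
          + complex_of_real (cmod (\<psi> t x) powr (2 * \<sigma>)) * \<psi> t x = 0) \<and>
     (\<forall>t\<in>{0..<Tc}. lp_norm p (\<psi> t) < \<infinity>) \<and>
     ((\<lambda>t. lp_norm p (\<psi> t)) \<longlongrightarrow> \<infinity>) (at_left Tc)"
proof -
  define n where "n = real CARD('n)"
  define \<beta> where "\<beta> = n - 1 / \<sigma>"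
  have n: "1 < \<sigma> * n" "\<sigma> * n < 2" "n > 0" using assms by (auto simp: n_def)
  have \<beta>: "\<beta> > 0" using n(1) assms(1) by (simp add: \<beta>_def field_simps)
  \<comment> \<open>For finite \<open>p\<close> the hypothesis amounts to
    \<open>n / P < \<beta>\<close>, integrability of the slower mode. Since
    \<open>\<sigma> * n - 1 < 1\<close>, it also gives \<open>\<sigma> * n < P\<close>, the sign
    condition for blow-up.\<close>
  have crit: "n / P < \<beta> \<and> P > 0 \<and> \<sigma> * n < P" if "p = ereal P" for P
  proof -
    have P: "\<sigma> * n / (\<sigma> * n - 1) < P" using assms(4) that by (simp add: n_def)
    have "\<sigma> * n \<le> \<sigma> * n / (\<sigma> * n - 1)"
      using n mult_left_le[of "\<sigma> * n - 1" "\<sigma> * n"] by (simp add: pos_le_divide_eq)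
    then have "\<sigma> * n < P" using P by linarith
    moreover from this have "P > 0" using n by linarith
    moreover have "n / P < \<beta>"
      using P n assms(1) \<open>P > 0\<close> by (simp add: \<beta>_def field_simps)
    ultimately show ?thesis by blast
  qed
  \<comment> \<open>For finite \<open>p\<close> this is the midpoint of \<open>n / p\<close> and
    \<open>\<beta>\<close>: below \<open>\<beta>\<close> for the decay estimate, above
    \<open>n / p\<close> for integrability. For infinite \<open>p\<close> any rate strictly between
    0 and \<open>\<beta>\<close> would serve.\<close>
  define b where "b = (if p = \<infinity> then \<beta> / 2 else (n / real_of_ereal p + \<beta>) / 2)"
  have b: "0 < b \<and> b < \<beta> \<and> (\<forall>P. p = ereal P \<longrightarrow> n < b * P)"
  proof (cases p)
    case (real P)
    note c = crit[OF real]
    have "b = (n / P + \<beta>) / 2" using real by (simp add: b_def)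
    moreover have "n / P > 0" using c n by simp
    moreover have "n / P < b" using c \<open>b = (n / P + \<beta>) / 2\<close> by simp
    then have "n < b * P" using c by (simp add: pos_divide_less_eq)
    ultimately show ?thesis using c real by auto
  next
    case PInf
    then show ?thesis using \<beta> by (simp add: b_def)
  next
    case MInf
    then show ?thesis using assms(4) by simp
  qed
  have b1: "0 < b" and b2: "b < real CARD('n) - 1 / \<sigma>" using b by (simp_all add: \<beta>_def n_def)
  obtain q q1 q2 C where q: "\<And>k. Ck_within k {0..} q" "\<And>s. s \<ge> 0 \<Longrightarrow> q s \<noteq> 0"
    and C: "C > 0" "\<And>s. s \<ge> 0 \<Longrightarrow> (cmod (q s))\<^sup>2 \<le> C * (1 + s) powr (- b)"
    and q1: "\<And>s. s \<ge> 0 \<Longrightarrow> (q has_vector_derivative q1 s) (at s within {0..})"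
    and q2: "\<And>s. s \<ge> 0 \<Longrightarrow> (q1 has_vector_derivative q2 s) (at s within {0..})"
    and ode: "\<And>s. s \<ge> 0 \<Longrightarrow> 4 * of_real s * q2 s + 2 * of_nat CARD('n) * q1 s + \<i> * of_real s * q1 s
        + \<i> / of_real (2 * \<sigma>) * q s + complex_of_real (cmod (q s) powr (2 * \<sigma>)) * q s = 0"
    by (rule self_similar_profile_exists[OF assms(1-3) b1 b2]) (rule that; assumption)
  have qc: "continuous_on {0..} q" using q(1) Ck_within_continuous by blast
  define \<alpha> where "\<alpha> = 1 / (2 * \<sigma>)"
  have \<alpha>: "\<alpha> > 0" using assms(1) by (simp add: \<alpha>_def)
  define \<psi> :: "real \<Rightarrow> real^'n \<Rightarrow> complex" where "\<psi> = self_similar \<alpha> q"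
  have cont: "continuous_on ({..<1} \<times> UNIV) (\<lambda>(t, x). \<psi> t x)"
    unfolding \<psi>_def by (rule continuous_on_self_similar[OF qc])
  have norms: "(\<forall>t<1. lp_norm p (\<psi> t) < \<infinity>) \<and> ((\<lambda>t. lp_norm p (\<psi> t)) \<longlongrightarrow> \<infinity>) (at_left 1)"
  proof (cases p)
    case (real P)
    note c = crit[OF real]
    have "b * P > real CARD('n)" using b real by (simp add: n_def)
    then have "\<exists>c0>0. \<forall>t<1. lp_norm p (\<psi> t) = ereal (c0 * (1 - t) powr (n / (2 * P) - \<alpha>))"
    proof (rule lp_norm_self_similar[of q C b P \<alpha>, where 'n='n, rotated 4])
      fix c0 :: real
      assume "c0 > 0" "\<And>t. t < 1 \<Longrightarrow> lp_norm (ereal P) (self_similar \<alpha> q t :: real^'n \<Rightarrow> complex) =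
        ereal (c0 * (1 - t) powr (real CARD('n) / (2 * P) - \<alpha>))"
      then show ?thesis unfolding \<psi>_def real n_def by blast
    qed (use qc q(2) C(2) c in auto)
    then obtain c0 where c0: "c0 > 0" "\<And>t. t < 1 \<Longrightarrow> lp_norm p (\<psi> t) = ereal (c0 * (1 - t) powr (n / (2 * P) - \<alpha>))"
      by blast
    have "n / (2 * P) - \<alpha> < 0" using c assms(1) by (simp add: \<alpha>_def field_simps)
    from powr_blowup[OF c0(1) this] have "((\<lambda>t. lp_norm p (\<psi> t)) \<longlongrightarrow> \<infinity>) (at_left 1)"
      by (rule Lim_transform_eventually) (auto intro!: eventually_at_leftI[of 0] simp: c0(2))
    then show ?thesis by (auto simp: c0(2))
  next
    case PInf
    have \<psi>c: "continuous_on UNIV (\<lambda>x. cmod (\<psi> t x))" if "t < 1" for t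
    proof -
      have "continuous_on UNIV (\<lambda>x. case (t, x) of (t, x) \<Rightarrow> \<psi> t x)"
        by (rule continuous_on_compose2[OF cont]) (use that in \<open>auto intro!: continuous_intros\<close>)
      then show ?thesis by (simp add: continuous_on_norm)
    qed
    have up: "lp_norm p (\<psi> t) < \<infinity>" if t: "t < 1" for t
    proof -
      have "cmod (\<psi> t x) \<le> (1 - t) powr (- \<alpha>) * sqrt C" for x
      proof -
        define s where "s = (x \<bullet> x) / (1 - t)"
        have s: "s \<ge> 0" using t by (simp add: s_def)
        have "(1 + s) powr (- b) \<le> (1 + s) powr 0" using s b by (intro powr_mono) auto
        then have "C * (1 + s) powr (- b) \<le> C" using s C(1) by (simp add: mult_left_le)
        then have "(cmod (q s))\<^sup>2 \<le> C" using C(2)[OF s] by linarith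
        then have "cmod (q s) \<le> sqrt C" by (rule real_le_rsqrt)
        then show ?thesis by (simp add: \<psi>_def self_similar_def s_def[symmetric] mult_left_mono)
      qed
      then have "esssup lborel (\<lambda>x. ereal (cmod (\<psi> t x))) \<le> ereal ((1 - t) powr (- \<alpha>) * sqrt C)"
        using \<psi>c[OF t] by (intro esssup_I) (auto intro!: borel_measurable_continuous_onI continuous_on_ereal)
      then show ?thesis using PInf by (auto simp: lp_norm_def)
    qed
    \<comment> \<open>The lower bound is the modulus at the spatial origin, which grows like
      \<open>(1 - t) powr (- \<alpha>)\<close>.\<close>
    have "((\<lambda>t. ereal (cmod (q 0) * (1 - t) powr (- \<alpha>))) \<longlongrightarrow> \<infinity>) (at_left 1)"
      using q(2)[of 0] \<alpha> by (intro powr_blowup) auto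
    note lower = this
    have "ereal (cmod (q 0) * (1 - t) powr (- \<alpha>)) \<le> lp_norm p (\<psi> t)" if "t < 1" for t
      using esssup_lborel_ge[OF \<psi>c[OF that], of 0] PInf by (simp add: lp_norm_def \<psi>_def self_similar_def mult.commute)
    then have "\<forall>\<^sub>F t in at_left 1. ereal (cmod (q 0) * (1 - t) powr (- \<alpha>)) \<le> lp_norm p (\<psi> t)"
      by (intro eventually_at_leftI[of 0]) auto
    from tendsto_sandwich[OF this _ lower tendsto_const]
    have "((\<lambda>t. lp_norm p (\<psi> t)) \<longlongrightarrow> \<infinity>) (at_left 1)" by simp
    then show ?thesis using up by blast
  next
    case MInf
    then show ?thesis using assms(4) by simp
  qed
  show ?thesis
  proof (intro exI[of _ \<psi>] exI[of _ 1] conjI ballI allI)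
    show "smooth_on ({0<..<1} \<times> UNIV) (\<lambda>(t, x). \<psi> t x)"
      unfolding \<psi>_def by (rule smooth_on_self_similar[OF q(1)])
    show "continuous_on ({0..<1} \<times> UNIV) (\<lambda>(t, x). \<psi> t x)"
      by (rule continuous_on_subset[OF cont]) auto
    show "\<i> * partial_t \<psi> t x + laplacian (\<psi> t) x + complex_of_real (cmod (\<psi> t x) powr (2 * \<sigma>)) * \<psi> t x = 0"
      if "t \<in> {0<..<1}" for t x
      unfolding \<psi>_def \<alpha>_def using that assms(1) q1 q2 ode by (intro self_similar_solves_NLS) auto
  qed (use norms in auto)
qed

end
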